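(* Let $n\in\mathbb N$, let $X=X_1\oplus\dots\oplus X_n$ be a complex Banach space decomposed into a direct sum of closed nonzero subspaces, and let $A=\{A_{ij}\}\in\mathbf M^+=\mathbf M^+(X_1,\dots,X_n)$ be a lower triangular operator matrix. Let $t\in\mathbb R$, $t\neq0$. Then: (1) for each choice of sign $\pm$, the matrix $\exp_{\pm,t}(A)$ is lower triangular, and its blocks $E_{\pm,i,j}$ with $i\ge j$ are $$E_{\pm,i,j}=\sum_{i=i_1>i_2>\dots>i_m=j}\exp_{\pm,t}^{[m-1]}(A;i_1,i_2,\dots,i_m);$$ (2) if the spectrum $\sigma(A)$ does not intersect the imaginary axis, then the matrix $g_t(A)$ is lower triangular, and its blocks $G_{i,j}$ with $i\ge j$ are $$G_{i,j}=\sum_{i=i_1>i_2>\dots>i_m=j}g_t^{[m-1]}(A;i_1,i_2,\dots,i_m).$$ In both formulas the sum runs over all $m\ge1$ and all strictly decreasing integer sequences $i_1>i_2>\dots>i_m$ with $i_1=i$ and $i_m=j$.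
   Context: $\mathbf M=\mathbf M(X_1,\dots,X_n)$ is the unital Banach algebra of all operator matrices $\{T_{ij}\}_{i,j=1}^n$ with $T_{ij}$ a bounded linear operator $X_j\to X_i$, with norm $\max_j\sum_i\|T_{ij}\|$; it is isomorphic to the algebra of bounded operators on $X$. $\mathbf M^+$ is the closed unital subalgebra of lower triangular matrices ($T_{ij}=0$ for $i<j$). For $A\in\mathbf M^+$, $\sigma(A)$ is the spectrum of $A$ in $\mathbf M$, and the causal spectrum $\sigma^+(A)$ is the spectrum of $A$ in the algebra $\mathbf M^+$. One has $\sigma(A)\subseteq\sigma^+(A)$, and $\sigma^+(A)=\bigcup_{i}\sigma(A_{ii})$. $\mathbf 1$ denotes the identity. Contours: for a compact set $K$ and a function $f$ analytic on an open set $D\supseteq K$ ($D$ need not be connected), "$\Gamma$ surrounds $K$" means that $\Gamma\subset D\setminus K$ is a finite union of closed curves having winding number $1$ about each point of $K$ and $0$ about each point outside $D$. The analytic functional calculus is $f(A)=\frac1{2\pi i}\int_\Gamma f(\lambda)(\lambda\mathbf 1-A)^{-1}d\lambda$ with $\Gamma$ surrounding $\sigma(A)$. Functions (for $t\ne0$): $\exp_{+,t}(\lambda)=e^{\lambda t}$ if $t>0$ and $0$ if $t<0$; $\exp_{-,t}(\lambda)=0$ if $t>0$ and $-e^{\lambda t}$ if $t<0$ ($\lambda\in\mathbb C$); $g_t(\lambda)=\exp_{-,t}(\lambda)$ if $\operatorname{Re}\lambda>0$ and $g_t(\lambda)=\exp_{+,t}(\lambda)$ if $\operatorname{Re}\lambda<0$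 ($g_t$ is undefined on the imaginary axis). For $f$ analytic in a neighborhood of $\sigma^+(A)$ and $n\ge i_1>i_2>\dots>i_m\ge1$, $$f^{[m-1]}(A;i_1,\dots,i_m)=\frac1{2\pi i}\int_\Gamma f(\lambda)(\lambda\mathbf1-A_{i_1,i_1})^{-1}A_{i_1,i_2}(\lambda\mathbf1-A_{i_2,i_2})^{-1}A_{i_2,i_3}\cdots A_{i_{m-1},i_m}(\lambda\mathbf1-A_{i_m,i_m})^{-1}\,d\lambda,$$ where $\Gamma$ surrounds $\sigma^+(A)$. (If $\sigma(A)$ does not meet the imaginary axis, then neither does $\sigma^+(A)$, so this applies to $f=g_t$.) Equivalently, $$f^{[m-1]}(A;i_1,\dots,i_m)=\frac1{(2\pi i)^m}\int_{\Gamma_{i_1}}\!\!\cdots\int_{\Gamma_{i_m}}f^{[m-1]}(\lambda_{i_1},\dots,\lambda_{i_m})(\lambda_{i_1}\mathbf1-A_{i_1,i_1})^{-1}A_{i_1,i_2}\cdots A_{i_{m-1},i_m}(\lambda_{i_m}\mathbf1-A_{i_m,i_m})^{-1}d\lambda_{i_1}\cdots d\lambda_{i_m},$$ with $\Gamma_{i_k}$ surrounding $\sigma(A_{i_k,i_k})$ and $f^{[m-1]}(\lambda_{i_1},\dots,\lambda_{i_m})$ the usual divided difference of $f$. *)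

theory Defs
  imports "HOL-Complex_Analysis.Complex_Analysis"
begin

section \<open>Complex Banach spaces\<close>

class complex_banach = banach +
  fixes scaleC :: "complex \<Rightarrow> 'a \<Rightarrow> 'a"  (infixr \<open>*\<^sub>C\<close> 75)
  assumes scaleC_add_right: "a *\<^sub>C (x + y) = a *\<^sub>C x + a *\<^sub>C y"
    and scaleC_add_left: "(a + b) *\<^sub>C x = a *\<^sub>C x + b *\<^sub>C x"
    and scaleC_scaleC: "a *\<^sub>C (b *\<^sub>C x) = (a * b) *\<^sub>C x"
    and scaleC_one: "1 *\<^sub>C x = x"
    and scaleR_scaleC: "r *\<^sub>R x = complex_of_real r *\<^sub>C x"
    and norm_scaleC: "norm (a *\<^sub>C x) = cmod a * norm x"

global_interpretation complex_vector:
  vector_space "scaleC :: complex \<Rightarrow> 'a \<Rightarrow> 'a :: complex_banach"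
  by standard (simp_all add: scaleC_add_right scaleC_add_left scaleC_scaleC scaleC_one)

lemma bounded_linear_scaleC: "bounded_linear (\<lambda>x :: 'a :: complex_banach. c *\<^sub>C x)"
  by (rule bounded_linear_intro [where K = "cmod c"])
    (simp_all add: scaleC_add_right scaleR_scaleC scaleC_scaleC norm_scaleC mult.commute)

instantiation complex :: complex_banach
begin
definition scaleC_complex :: "complex \<Rightarrow> complex \<Rightarrow> complex"
  where "scaleC_complex = (*)"
instance
  by standard
    (simp_all add: scaleC_complex_def algebra_simps scaleR_conv_of_real norm_mult)
end

instantiation blinfun :: (real_normed_vector, complex_banach) complex_banach
begin
lift_definition scaleC_blinfun :: "complex \<Rightarrow> 'a \<Rightarrow>\<^sub>L 'b \<Rightarrow> 'a \<Rightarrow>\<^sub>L 'b"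
  is "\<lambda>c T x. c *\<^sub>C T x"
  by (rule bounded_linear_compose [OF bounded_linear_scaleC])
instance
proof
  fix c :: complex and T :: "'a \<Rightarrow>\<^sub>L 'b"
  have le: "norm (a *\<^sub>C S) \<le> cmod a * norm S" for a and S :: "'a \<Rightarrow>\<^sub>L 'b"
    by (rule norm_blinfun_bound)
      (simp_all add: scaleC_blinfun.rep_eq norm_scaleC mult.assoc mult_left_mono norm_blinfun)
  show "norm (c *\<^sub>C T) = cmod c * norm T"
  proof (cases "c = 0")
    case True
    then show ?thesis using le [of c T] by simp
  next
    case False
    have "inverse c *\<^sub>C (c *\<^sub>C T) = T"
      using False by (intro blinfun_eqI) (simp add: scaleC_blinfun.rep_eq scaleC_scaleC scaleC_one)
    with le [of "inverse c" "c *\<^sub>C T"] False have "cmod c * norm T \<le> norm (c *\<^sub>C T)"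
      by (simp add: norm_divide field_simps)
    with le [of c T] show ?thesis by simp
  qed
qed (transfer; simp add: scaleC_add_right scaleC_add_left scaleC_scaleC scaleC_one scaleR_scaleC)+
end


section \<open>Direct sums of closed subspaces\<close>

definition direct_decomp :: "nat \<Rightarrow> (nat \<Rightarrow> 'a::complex_banach set) \<Rightarrow> bool" where
  "direct_decomp n X \<longleftrightarrow>
     (\<forall>i\<in>{1..n}. complex_vector.subspace (X i) \<and> closed (X i) \<and> X i \<noteq> {0}) \<and>
     (\<forall>x. \<exists>!u. u \<in> (\<Pi>\<^sub>E i\<in>{1..n}. X i) \<and> x = (\<Sum>i\<in>{1..n}. u i))"

definition component :: "nat \<Rightarrow> (nat \<Rightarrow> 'a::complex_banach set) \<Rightarrow> nat \<Rightarrow> 'a \<Rightarrow> 'a" where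
  "component n X i x = (THE u. u \<in> (\<Pi>\<^sub>E i\<in>{1..n}. X i) \<and> x = (\<Sum>i\<in>{1..n}. u i)) i"


section \<open>The algebras of operator matrices\<close>

text \<open>
  A bounded operator from \<open>X j\<close> to \<open>X i\<close> is represented by its extension by zero on the other
  summands, an element of the Banach space of bounded operators on the whole space. The component
  projections of a direct sum of closed subspaces of a Banach space are bounded (open mapping
  theorem), so this is a bijection and the two operator norms are equivalent. For the same reason
  \<open>id_block\<close>, which represents the identity of \<open>X i\<close>, is indeed the component projection.
  Complex linearity has to be required separately, since the library's bounded operators are
  only real linear.
\<close>

definition blocks ::
    "nat \<Rightarrow> (nat \<Rightarrow> 'a::complex_banach set) \<Rightarrow> nat \<Rightarrow> nat \<Rightarrow> ('a \<Rightarrow>\<^sub>L 'a) set" where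
  "blocks n X i j =
     {T. Vector_Spaces.linear scaleC scaleC (blinfun_apply T) \<and>
         (\<forall>x\<in>X j. blinfun_apply T x \<in> X i) \<and>
         (\<forall>k\<in>{1..n} - {j}. \<forall>x\<in>X k. blinfun_apply T x = 0)}"

definition id_block :: "nat \<Rightarrow> (nat \<Rightarrow> 'a::complex_banach set) \<Rightarrow> nat \<Rightarrow> 'a \<Rightarrow>\<^sub>L 'a" where
  "id_block n X i = Blinfun (component n X i)"

type_synonym 'a opmat = "nat \<Rightarrow> nat \<Rightarrow> 'a \<Rightarrow>\<^sub>L 'a"

definition opmats :: "nat \<Rightarrow> (nat \<Rightarrow> 'a::complex_banach set) \<Rightarrow> 'a opmat set" where
  "opmats n X =
     {T. \<forall>i j. if i \<in> {1..n} \<and> j \<in> {1..n} then T i j \<in> blocks n X i j else T i j = 0}"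

definition lower_opmats :: "nat \<Rightarrow> (nat \<Rightarrow> 'a::complex_banach set) \<Rightarrow> 'a opmat set" where
  "lower_opmats n X = {T \<in> opmats n X. \<forall>i j. i < j \<longrightarrow> T i j = 0}"

definition mat_one :: "nat \<Rightarrow> (nat \<Rightarrow> 'a::complex_banach set) \<Rightarrow> 'a opmat" where
  "mat_one n X = (\<lambda>i j. if i \<in> {1..n} \<and> i = j then id_block n X i else 0)"

definition mat_mult :: "nat \<Rightarrow> 'a::complex_banach opmat \<Rightarrow> 'a opmat \<Rightarrow> 'a opmat" where
  "mat_mult n S T = (\<lambda>i j. \<Sum>k\<in>{1..n}. S i k o\<^sub>L T k j)"

definition is_inverse_in ::
    "'a::complex_banach opmat set \<Rightarrow> nat \<Rightarrow> (nat \<Rightarrow> 'a set) \<Rightarrow> 'a opmat \<Rightarrow> 'a opmat \<Rightarrow> bool" where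
  "is_inverse_in \<A> n X T S \<longleftrightarrow>
     S \<in> \<A> \<and> mat_mult n S T = mat_one n X \<and> mat_mult n T S = mat_one n X"

definition shifted ::
    "nat \<Rightarrow> (nat \<Rightarrow> 'a::complex_banach set) \<Rightarrow> 'a opmat \<Rightarrow> complex \<Rightarrow> 'a opmat" where
  "shifted n X A z = (\<lambda>i j. z *\<^sub>C mat_one n X i j - A i j)"

definition spectrum_in ::
    "'a::complex_banach opmat set \<Rightarrow> nat \<Rightarrow> (nat \<Rightarrow> 'a set) \<Rightarrow> 'a opmat \<Rightarrow> complex set" where
  "spectrum_in \<A> n X A = {z. \<not> (\<exists>S. is_inverse_in \<A> n X (shifted n X A z) S)}"

abbreviation spec :: "nat \<Rightarrow> (nat \<Rightarrow> 'a::complex_banach set) \<Rightarrow> 'a opmat \<Rightarrow> complex set" where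
  "spec n X \<equiv> spectrum_in (opmats n X) n X"

abbreviation causal_spec ::
    "nat \<Rightarrow> (nat \<Rightarrow> 'a::complex_banach set) \<Rightarrow> 'a opmat \<Rightarrow> complex set" where
  "causal_spec n X \<equiv> spectrum_in (lower_opmats n X) n X"

definition resolvent ::
    "nat \<Rightarrow> (nat \<Rightarrow> 'a::complex_banach set) \<Rightarrow> 'a opmat \<Rightarrow> complex \<Rightarrow> 'a opmat" where
  "resolvent n X A z = (THE S. is_inverse_in (opmats n X) n X (shifted n X A z) S)"


section \<open>Contours and the analytic functional calculus\<close>

text \<open>A contour is a finite list of closed, piecewise continuously differentiable curves.\<close>

definition surrounds :: "complex set \<Rightarrow> (real \<Rightarrow> complex) list \<Rightarrow> complex set \<Rightarrow> bool" where
  "surrounds D \<Gamma> K \<longleftrightarrow>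
     (\<forall>\<gamma>\<in>set \<Gamma>. valid_path \<gamma> \<and> pathfinish \<gamma> = pathstart \<gamma> \<and> path_image \<gamma> \<subseteq> D - K) \<and>
     (\<forall>z\<in>K. (\<Sum>\<gamma>\<leftarrow>\<Gamma>. winding_number \<gamma> z) = 1) \<and>
     (\<forall>z. z \<notin> D \<longrightarrow> (\<Sum>\<gamma>\<leftarrow>\<Gamma>. winding_number \<gamma> z) = 0)"

text \<open>\<open>(\<integral>\<^bsub>\<Gamma>\<^esub> F(z) dz) / (2\<pi>\<i>)\<close> for a Banach space valued \<open>F\<close>, cf. \<open>has_contour_integral\<close>.\<close>

definition cauchy_integral ::
    "(real \<Rightarrow> complex) list \<Rightarrow> (complex \<Rightarrow> 'b::complex_banach) \<Rightarrow> 'b" where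
  "cauchy_integral \<Gamma> F =
     (1 / (2 * of_real pi * \<i>)) *\<^sub>C
       (\<Sum>\<gamma>\<leftarrow>\<Gamma>. integral {0..1} (\<lambda>s. vector_derivative \<gamma> (at s within {0..1}) *\<^sub>C F (\<gamma> s)))"

text \<open>
  In the following two definitions \<open>f\<close> is meant to be analytic on the open set \<open>D\<close>, which contains
  the spectrum in question; the result does not depend on the choice of the contour. Since the
  norm of a matrix is the maximum of its column sums of block norms, matrix valued integrals are
  taken blockwise.
\<close>

definition func_calc ::
    "nat \<Rightarrow> (nat \<Rightarrow> 'a::complex_banach set) \<Rightarrow> complex set \<Rightarrow> (complex \<Rightarrow> complex) \<Rightarrow>
     'a opmat \<Rightarrow> 'a opmat" where
  "func_calc n X D f A =
     (let \<Gamma> = (SOME \<Gamma>. surrounds D \<Gamma> (spec n X A))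
      in (\<lambda>i j. cauchy_integral \<Gamma> (\<lambda>z. f z *\<^sub>C resolvent n X A z i j)))"

definition block_resolvent ::
    "nat \<Rightarrow> (nat \<Rightarrow> 'a::complex_banach set) \<Rightarrow> 'a opmat \<Rightarrow> nat \<Rightarrow> complex \<Rightarrow> 'a \<Rightarrow>\<^sub>L 'a" where
  "block_resolvent n X A i z =
     (THE S. S \<in> blocks n X i i \<and>
        S o\<^sub>L (z *\<^sub>C id_block n X i - A i i) = id_block n X i \<and>
        (z *\<^sub>C id_block n X i - A i i) o\<^sub>L S = id_block n X i)"

fun resolvent_chain ::
    "nat \<Rightarrow> (nat \<Rightarrow> 'a::complex_banach set) \<Rightarrow> 'a opmat \<Rightarrow> complex \<Rightarrow> nat list \<Rightarrow> 'a \<Rightarrow>\<^sub>L 'a" where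
  "resolvent_chain n X A z [] = undefined"
| "resolvent_chain n X A z [i] = block_resolvent n X A i z"
| "resolvent_chain n X A z (i # j # is) =
     block_resolvent n X A i z o\<^sub>L A i j o\<^sub>L resolvent_chain n X A z (j # is)"

text \<open>\<open>f\<^sup>[\<^sup>m\<^sup>-\<^sup>1\<^sup>](A; i\<^sub>1, \<dots>, i\<^sub>m)\<close>, where the list is \<open>[i\<^sub>1, \<dots>, i\<^sub>m]\<close>.\<close>

definition divdiff_calc ::
    "nat \<Rightarrow> (nat \<Rightarrow> 'a::complex_banach set) \<Rightarrow> complex set \<Rightarrow> (complex \<Rightarrow> complex) \<Rightarrow>
     'a opmat \<Rightarrow> nat list \<Rightarrow> 'a \<Rightarrow>\<^sub>L 'a" where
  "divdiff_calc n X D f A is =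
     (let \<Gamma> = (SOME \<Gamma>. surrounds D \<Gamma> (causal_spec n X A))
      in cauchy_integral \<Gamma> (\<lambda>z. f z *\<^sub>C resolvent_chain n X A z is))"

definition decreasing_seqs :: "nat \<Rightarrow> nat \<Rightarrow> nat list set" where
  "decreasing_seqs i j = {is. is \<noteq> [] \<and> sorted_wrt (>) is \<and> hd is = i \<and> last is = j}"


section \<open>The functions\<close>

definition exp_plus :: "real \<Rightarrow> complex \<Rightarrow> complex" where
  "exp_plus t z = (if t > 0 then exp (z * of_real t) else 0)"

definition exp_minus :: "real \<Rightarrow> complex \<Rightarrow> complex" where
  "exp_minus t z = (if t > 0 then 0 else - exp (z * of_real t))"

definition g_fun :: "real \<Rightarrow> complex \<Rightarrow> complex" where
  "g_fun t z = (if Re z > 0 then exp_minus t z else if Re z < 0 then exp_plus t z else undefined)"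

end

theory Submission
  imports Defs
begin

text \<open>
  Identify a matrix with a complex linear operator on the whole space; boundedness of the component
  projections is a case of the open mapping theorem. On a contour around the causal spectrum the
  resolvent is lower triangular, and solving \<open>(z - A) R = 1\<close> row by row expresses its entries as sums
  of products of block resolvents over decreasing index sequences; integration gives the formula.

  The functional calculus, however, uses a contour around the smaller set \<open>\<sigma>(A)\<close>, where the resolvent
  need not be lower triangular. Hence it has to be shown that two contours with the same winding
  numbers on \<open>\<sigma>(A)\<close> give the same integral, in the style of Dixon's proof of Cauchy's theorem. Finally,
  the causal spectrum avoids the imaginary axis if \<open>\<sigma>(A)\<close> does: the resolvent is lower triangular far
  out on the axis, and being lower triangular is an open and closed condition along it.
\<close>

section \<open>Vector-valued holomorphic functions\<close>

text \<open>The contours of the two calculi are arbitrary choices about which only winding numbers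
  are known, and a curve of one need not correspond to a curve of the other. Cauchy transforms and
  Liouville's theorem suit this situation, since they see nothing but the totals of the winding
  numbers. Their scalar ingredient is easy for the domains at hand: the plane and the union of two
  open half-planes have convex components, so every closed curve runs inside a convex part of the
  domain.

  The spectrum and the causal spectrum belong to two closed algebras of operators on the same space.
  Since inverses are unique, there is a single resolvent, and the algebras differ only in whether
  its values belong to them. Closedness of the algebra of lower triangular operators is used twice:
  for Neumann series to stay inside it, and for the closed half of the argument along the imaginary
  axis.\<close>

lemma bounded_bilinear_scaleC:
  "bounded_bilinear (scaleC :: complex \<Rightarrow> 'a \<Rightarrow> 'a::complex_banach)"
proof
  fix a :: complex and b :: 'a and r :: real
  show "(r *\<^sub>R a) *\<^sub>C b = r *\<^sub>R (a *\<^sub>C b)" "a *\<^sub>C (r *\<^sub>R b) = r *\<^sub>R (a *\<^sub>C b)"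
    by (simp_all add: scaleR_scaleC scaleC_scaleC scaleC_complex_def mult.commute)
  show "\<exists>K. \<forall>a (b :: 'a). norm (a *\<^sub>C b) \<le> norm a * norm b * K"
    by (intro exI[of _ 1]) (simp add: norm_scaleC)
qed (simp_all add: scaleC_add_left scaleC_add_right)

interpretation scaleC: bounded_bilinear "scaleC :: complex \<Rightarrow> 'a \<Rightarrow> 'a::complex_banach"
  by (rule bounded_bilinear_scaleC)

lemmas [continuous_intros] = scaleC.continuous_on

lemma scaleC_complex_eq: "c *\<^sub>C (x :: complex) = c * x"
  by (simp add: scaleC_complex_def)

lemma scaleC_zero [simp]: "0 *\<^sub>C (x :: 'a::complex_banach) = 0" "c *\<^sub>C (0 :: 'a) = 0"
  by (simp_all add: scaleC.zero_left scaleC.zero_right)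

text \<open>Continuity of the derivative is built in so that primitives and Liouville's theorem
  follow from differentiation under the integral sign, directly for values in a Banach
  space.\<close>

definition C1_holomorphic :: "(complex \<Rightarrow> 'b::complex_banach) \<Rightarrow> complex set \<Rightarrow> bool" where
  "C1_holomorphic F S \<longleftrightarrow>
     (\<exists>F'. continuous_on S F' \<and> (\<forall>z\<in>S. (F has_derivative (\<lambda>h. h *\<^sub>C F' z)) (at z)))"

lemma C1_holomorphicE:
  assumes "C1_holomorphic F S"
  obtains F' where "continuous_on S F'"
    "\<And>z. z \<in> S \<Longrightarrow> (F has_derivative (\<lambda>h. h *\<^sub>C F' z)) (at z)"
  using assms unfolding C1_holomorphic_def by blast

lemma C1_holomorphic_subset: "C1_holomorphic F S \<Longrightarrow> T \<subseteq> S \<Longrightarrow> C1_holomorphic F T"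
  unfolding C1_holomorphic_def by (meson continuous_on_subset subsetD)

lemma C1_holomorphic_continuous_on:
  assumes "C1_holomorphic F S" shows "continuous_on S F"
  using assms unfolding C1_holomorphic_def
  by (meson continuous_at_imp_continuous_on has_derivative_continuous)

lemma C1_holomorphic_const [simp]: "C1_holomorphic (\<lambda>_. c) S"
  unfolding C1_holomorphic_def by (intro exI[of _ "\<lambda>_. 0"]) simp

lemma C1_holomorphic_diff:
  assumes "C1_holomorphic F S" "C1_holomorphic G S"
  shows "C1_holomorphic (\<lambda>z. F z - G z) S"
proof -
  obtain F' G' where "continuous_on S F'" "continuous_on S G'"
    "\<And>z. z \<in> S \<Longrightarrow> (F has_derivative (\<lambda>h. h *\<^sub>C F' z)) (at z)"
    "\<And>z. z \<in> S \<Longrightarrow> (G has_derivative (\<lambda>h. h *\<^sub>C G' z)) (at z)"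
    using assms unfolding C1_holomorphic_def by blast
  then show ?thesis unfolding C1_holomorphic_def
    by (intro exI[of _ "\<lambda>z. F' z - G' z"])
      (auto intro!: continuous_intros derivative_eq_intros simp: scaleC.diff_right)
qed

lemma C1_holomorphic_add:
  assumes "C1_holomorphic F S" "C1_holomorphic G S"
  shows "C1_holomorphic (\<lambda>z. F z + G z) S"
  using C1_holomorphic_diff[OF assms(1) C1_holomorphic_diff[OF C1_holomorphic_const assms(2)], of 0]
  by simp

lemma C1_holomorphic_sum:
  "(\<And>i. i \<in> I \<Longrightarrow> C1_holomorphic (F i) S) \<Longrightarrow> C1_holomorphic (\<lambda>z. \<Sum>i\<in>I. F i z) S"
  by (induction I rule: infinite_finite_induct) (auto intro: C1_holomorphic_add)

lemma C1_holomorphic_sum_list: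
  "(\<And>x. x \<in> set xs \<Longrightarrow> C1_holomorphic (F x) S) \<Longrightarrow> C1_holomorphic (\<lambda>z. \<Sum>x\<leftarrow>xs. F x z) S"
  by (induction xs) (auto intro: C1_holomorphic_add)

lemma C1_holomorphic_cong_open:
  assumes "C1_holomorphic F S" "open S" "\<And>z. z \<in> S \<Longrightarrow> F z = G z"
  shows "C1_holomorphic G S"
  using assms unfolding C1_holomorphic_def by (meson has_derivative_transform_within_open)

text \<open>On the overlap the two derivatives agree (evaluate them at \<open>h = 1\<close>), and
  openness lets the pieces combine to a continuous derivative. This glues the two formulas for the
  entire function in the proof of contour independence.\<close>

lemma C1_holomorphic_Un:
  assumes "C1_holomorphic F S" "C1_holomorphic F T" "open S" "open T"
  shows "C1_holomorphic F (S \<union> T)"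
proof -
  obtain F' where F': "continuous_on S F'"
    "\<And>z. z \<in> S \<Longrightarrow> (F has_derivative (\<lambda>h. h *\<^sub>C F' z)) (at z)"
    using assms(1) by (rule C1_holomorphicE) blast
  obtain G' where G': "continuous_on T G'"
    "\<And>z. z \<in> T \<Longrightarrow> (F has_derivative (\<lambda>h. h *\<^sub>C G' z)) (at z)"
    using assms(2) by (rule C1_holomorphicE) blast
  have eq: "F' z = G' z" if "z \<in> S" "z \<in> T" for z
    using has_derivative_unique[OF F'(2) G'(2), OF that]
    by (metis scaleC_one)
  let ?H = "\<lambda>z. if z \<in> S then F' z else G' z"
  have "continuous_on S ?H" "continuous_on T ?H"
    using F'(1) G'(1) eq by (auto cong: continuous_on_cong_simp intro: continuous_on_eq)
  then have "continuous_on (S \<union> T) ?H"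
    using assms(3,4) by (rule continuous_on_open_Un[rotated 2])
  then show ?thesis
    unfolding C1_holomorphic_def using F' G' by (intro exI[of _ ?H]) auto
qed

lemma C1_holomorphic_scaleC:
  assumes "f holomorphic_on S" "open S" "C1_holomorphic F S"
  shows "C1_holomorphic (\<lambda>z. f z *\<^sub>C F z) S"
proof -
  obtain F' where F': "continuous_on S F'"
    "\<And>z. z \<in> S \<Longrightarrow> (F has_derivative (\<lambda>h. h *\<^sub>C F' z)) (at z)"
    using assms(3) by (rule C1_holomorphicE) blast
  have f: "(f has_derivative (\<lambda>h. h * deriv f z)) (at z)" if "z \<in> S" for z
    using holomorphic_derivI[OF assms(1,2) that]
    by (simp add: has_field_derivative_def mult.commute[of _ "deriv f z"])
  have "((\<lambda>z. f z *\<^sub>C F z) has_derivative (\<lambda>h. h *\<^sub>C (deriv f z *\<^sub>C F z + f z *\<^sub>C F' z))) (at z)"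
    if "z \<in> S" for z
    using scaleC.FDERIV[OF f[OF that] F'(2)[OF that]]
    by (rule has_derivative_eq_rhs)
      (auto simp: scaleC_scaleC scaleC_add_right mult.commute)
  moreover have "continuous_on S (\<lambda>z. deriv f z *\<^sub>C F z + f z *\<^sub>C F' z)"
    by (intro continuous_intros F' C1_holomorphic_continuous_on assms holomorphic_on_imp_continuous_on
        holomorphic_deriv)
  ultimately show ?thesis
    unfolding C1_holomorphic_def by blast
qed

lemma C1_holomorphic_complex:
  assumes "f holomorphic_on S" "open S" shows "C1_holomorphic f S"
  using C1_holomorphic_scaleC[OF assms, of "\<lambda>_. 1 :: complex"] by (simp add: scaleC_complex_eq)

lemma C1_holomorphic_bounded_linear:
  assumes "C1_holomorphic F S" "bounded_linear L" "\<And>c x. L (c *\<^sub>C x) = c *\<^sub>C L x"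
  shows "C1_holomorphic (\<lambda>z. L (F z)) S"
proof -
  obtain F' where F': "continuous_on S F'"
    "\<And>z. z \<in> S \<Longrightarrow> (F has_derivative (\<lambda>h. h *\<^sub>C F' z)) (at z)"
    using assms(1) by (rule C1_holomorphicE) blast
  then show ?thesis
    unfolding C1_holomorphic_def
    using bounded_linear.continuous_on[OF assms(2)] bounded_linear.has_derivative[OF assms(2) F'(2)]
    by (intro exI[of _ "\<lambda>z. L (F' z)"]) (simp add: assms(3))
qed

text \<open>Differentiating under the integral sign, \<open>F(a + t (z - a)) + t (z - a) F'(a + t (z - a))\<close> is
  the derivative of \<open>t F(a + t (z - a))\<close> with respect to \<open>t\<close>.\<close>

lemma C1_holomorphic_primitive:
  fixes F :: "complex \<Rightarrow> 'b::complex_banach"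
  assumes "C1_holomorphic F (ball a r)"
  obtains G where "\<And>z. z \<in> ball a r \<Longrightarrow> (G has_derivative (\<lambda>h. h *\<^sub>C F z)) (at z)"
proof -
  obtain F' where F': "continuous_on (ball a r) F'"
    "\<And>z. z \<in> ball a r \<Longrightarrow> (F has_derivative (\<lambda>h. h *\<^sub>C F' z)) (at z)"
    using assms by (rule C1_holomorphicE) blast
  note cF = C1_holomorphic_continuous_on[OF assms]
  define p where "p z t = a + of_real t * (z - a)" for z and t :: real
  have p_in: "p z t \<in> ball a r" if "z \<in> ball a r" "t \<in> cbox 0 1" for z t
  proof -
    have "norm (of_real t * (z - a)) \<le> 1 * norm (z - a)"
      unfolding norm_mult using that by (intro mult_right_mono) auto
    with that show ?thesis by (simp add: p_def dist_norm norm_minus_commute)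
  qed
  have cp: "continuous_on S (\<lambda>x. p (f x) (g x))" if "continuous_on S f" "continuous_on S g"
    for S and f :: "complex \<times> real \<Rightarrow> complex" and g :: "complex \<times> real \<Rightarrow> real"
    unfolding p_def using that by (intro continuous_intros)
  define D where "D z t = F (p z t) + (of_real t * (z - a)) *\<^sub>C F' (p z t)" for z and t :: real
  have dp: "((\<lambda>z. p z t) has_derivative (\<lambda>h. of_real t * h)) (at z)" for z t
    unfolding p_def by (auto intro!: derivative_eq_intros)
  have dpt: "((\<lambda>t. p z t) has_vector_derivative (z - a)) (at t within S)" for z t S
    unfolding p_def has_vector_derivative_def
    by (auto intro!: derivative_eq_intros simp: scaleR_conv_of_real)
  have contp: "continuous_on (ball a r \<times> cbox 0 1) (\<lambda>x. p (fst x) (snd x))"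
    by (intro cp continuous_intros)
  have contF: "continuous_on (ball a r \<times> cbox 0 1) (\<lambda>x. F (p (fst x) (snd x)))"
    by (rule continuous_on_compose2[OF cF contp]) (auto simp: p_in simp del: mem_ball)
  have contF': "continuous_on (ball a r \<times> cbox 0 1) (\<lambda>x. F' (p (fst x) (snd x)))"
    by (rule continuous_on_compose2[OF F'(1) contp]) (auto simp: p_in simp del: mem_ball)
  have contD: "continuous_on (ball a r \<times> cbox 0 1) (\<lambda>x. D (fst x) (snd x))"
    unfolding D_def by (intro continuous_intros contF contF')
  have slice: "continuous_on (cbox 0 1) (\<lambda>t. K z t)"
    if "continuous_on (ball a r \<times> cbox 0 1) (\<lambda>x. K (fst x) (snd x))" "z \<in> ball a r"
    for K :: "complex \<Rightarrow> real \<Rightarrow> 'b" and z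
    by (rule continuous_on_compose2[OF that(1), where f = "\<lambda>t. (z, t)", simplified])
      (use that(2) in \<open>auto intro!: continuous_intros\<close>)
  define G where "G z = integral (cbox 0 1) (\<lambda>t. (z - a) *\<^sub>C F (p z t))" for z
  have "(G has_derivative (\<lambda>h. h *\<^sub>C F z)) (at z)" if z: "z \<in> ball a r" for z
  proof -
    \<comment> \<open>\<open>scaleC.prod_left (D z t)\<close> is the bounded operator sending
      \<open>h\<close> to the multiple of \<open>D z t\<close> by \<open>h\<close>; the Leibniz rule
      wants derivatives as such operators, over a convex domain, here the ball.\<close>
    have "(G has_derivative integral (cbox 0 1) (\<lambda>t. scaleC.prod_left (D z t))) (at z within ball a r)"
      unfolding G_def
    proof (rule leibniz_rule)
      fix z t assume zt: "z \<in> ball a r" "t \<in> cbox 0 (1::real)"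
      have dF: "((\<lambda>z. F (p z t)) has_derivative (\<lambda>h. (of_real t * h) *\<^sub>C F' (p z t))) (at z)"
        using has_derivative_compose[OF dp F'(2)[OF p_in[OF zt]]] .
      have "((\<lambda>z. z - a) has_derivative (\<lambda>h. h)) (at z)"
        by (auto intro!: derivative_eq_intros)
      from has_derivative_at_withinI[OF scaleC.FDERIV[OF this dF]]
      show "((\<lambda>z. (z - a) *\<^sub>C F (p z t)) has_derivative blinfun_apply (scaleC.prod_left (D z t)))
              (at z within ball a r)"
        by (rule has_derivative_eq_rhs)
          (simp add: D_def scaleC_scaleC scaleC_add_right fun_eq_iff mult.commute mult.left_commute)
    next
      fix z assume "z \<in> ball a r"
      then show "(\<lambda>t. (z - a) *\<^sub>C F (p z t)) integrable_on cbox 0 1"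
        by (intro integrable_continuous continuous_intros slice[OF contF])
    next
      show "continuous_on (ball a r \<times> cbox 0 1) (\<lambda>(z, t). scaleC.prod_left (D z t))"
        using bounded_linear.continuous_on[OF scaleC.bounded_linear_prod_left contD]
        by (simp add: split_beta)
    qed (use z in auto)
    moreover have "integral (cbox 0 1) (\<lambda>t. scaleC.prod_left (D z t)) = scaleC.prod_left (F z)"
    proof -
      have "(D z has_integral (1 *\<^sub>R F (p z 1) - 0 *\<^sub>R F (p z 0))) {0..1}"
      proof (rule fundamental_theorem_of_calculus)
        fix t :: real assume t: "t \<in> {0..1}"
        then have "F (p z t) + t *\<^sub>R ((z - a) *\<^sub>C F' (p z t)) = D z t"
          by (simp add: D_def scaleR_scaleC scaleC_scaleC)
        moreover have "((\<lambda>t. F (p z t)) has_vector_derivative (z - a) *\<^sub>C F' (p z t)) (at t within {0..1})"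
          using has_derivative_compose[OF dpt[unfolded has_vector_derivative_def] F'(2)[OF p_in[OF z]], of t] t
          by (simp add: has_vector_derivative_def scaleC.scaleR_left)
        then have "((\<lambda>t. t *\<^sub>R F (p z t)) has_vector_derivative
            (t *\<^sub>R ((z - a) *\<^sub>C F' (p z t)) + 1 *\<^sub>R F (p z t))) (at t within {0..1})"
          by (intro has_vector_derivative_scaleR) (auto intro!: derivative_eq_intros)
        ultimately show "((\<lambda>t. t *\<^sub>R F (p z t)) has_vector_derivative D z t) (at t within {0..1})"
          by (simp add: add.commute)
      qed simp
      then have "(D z has_integral F z) (cbox 0 1)" by (simp add: p_def)
      from has_integral_linear[OF this scaleC.bounded_linear_prod_left]
      show ?thesis by (simp add: o_def integral_unique)
    qed
    ultimately show ?thesis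
      using z by (simp add: at_within_open[OF _ open_ball])
  qed
  then show ?thesis using that by blast
qed

text \<open>The mean \<open>M s\<close> of \<open>\<Phi>\<close> over the circle of radius \<open>s\<close> is constant, since its derivative is
  the integral of a total derivative along the circle.\<close>

lemma C1_holomorphic_Liouville_0:
  fixes \<Phi> :: "complex \<Rightarrow> 'b::complex_banach"
  assumes "C1_holomorphic \<Phi> UNIV" "(\<Phi> \<longlongrightarrow> 0) at_infinity"
  shows "\<Phi> z = 0"
proof -
  obtain \<Phi>' where \<Phi>': "continuous_on UNIV \<Phi>'" "\<And>z. (\<Phi> has_derivative (\<lambda>h. h *\<^sub>C \<Phi>' z)) (at z)"
    using assms(1) by (rule C1_holomorphicE) blast
  note c\<Phi> = C1_holomorphic_continuous_on[OF assms(1)]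
  define e where "e t = cis (2 * pi * t)" for t
  have ce [continuous_intros]: "continuous_on S (\<lambda>x. e (f x))" if "continuous_on S f"
    for S and f :: "'c::topological_space \<Rightarrow> real"
    unfolding e_def using that by (intro continuous_intros)
  have c1: "continuous_on S (\<lambda>x. \<Phi> (f x))" if "continuous_on S f"
    for S and f :: "'c::topological_space \<Rightarrow> complex"
    by (rule continuous_on_compose2[OF c\<Phi> that]) auto
  have c2: "continuous_on S (\<lambda>x. \<Phi>' (f x))" if "continuous_on S f"
    for S and f :: "'c::topological_space \<Rightarrow> complex"
    by (rule continuous_on_compose2[OF \<Phi>'(1) that]) auto
  define M where "M s = integral (cbox 0 1) (\<lambda>t. \<Phi> (z + of_real s * e t))" for s
  have dM: "(M has_vector_derivative integral (cbox 0 1) (\<lambda>t. e t *\<^sub>C \<Phi>' (z + of_real s * e t))) (at s)"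
    (is "(M has_vector_derivative ?D s) _") for s
    unfolding M_def
  proof (rule leibniz_rule_vector_derivative)
    fix s t :: real
    have "((\<lambda>s. z + of_real s * e t) has_derivative (\<lambda>h. of_real h * e t)) (at s)"
      by (auto intro!: derivative_eq_intros)
    from has_derivative_compose[OF this \<Phi>'(2)]
    show "((\<lambda>s. \<Phi> (z + of_real s * e t)) has_vector_derivative e t *\<^sub>C \<Phi>' (z + of_real s * e t)) (at s)"
      by (simp add: has_vector_derivative_def scaleR_scaleC scaleC_scaleC)
  qed (auto intro!: integrable_continuous_real continuous_intros c1 c2 simp: split_beta)
  \<comment> \<open>Multiplied by \<open>2 pi i s\<close>, the integrand becomes the derivative of
    \<open>\<Phi>\<close> along a closed circle. Dividing by this factor again requires
    \<open>s > 0\<close>.\<close>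
  have D0: "?D s = 0" if "s > 0" for s
  proof -
    have "((\<lambda>t. (of_real s * (2 * of_real pi * \<i>) * e t) *\<^sub>C \<Phi>' (z + of_real s * e t))
        has_integral \<Phi> (z + of_real s * e 1) - \<Phi> (z + of_real s * e 0)) {0..1}"
    proof (rule fundamental_theorem_of_calculus)
      fix t :: real
      have "((\<lambda>w. z + of_real s * exp (\<i> * (2 * of_real pi * w))) has_field_derivative
              of_real s * (2 * of_real pi * \<i>) * e t) (at (of_real t))"
        unfolding e_def cis_conv_exp by (auto intro!: derivative_eq_intros)
      from has_vector_derivative_real_field[OF this]
      have "((\<lambda>t. z + of_real s * e t) has_derivative
              (\<lambda>h. h *\<^sub>R (of_real s * (2 * of_real pi * \<i>) * e t))) (at t within {0..1})"
        unfolding e_def cis_conv_exp has_vector_derivative_def by simp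
      from has_derivative_compose[OF this \<Phi>'(2)]
      show "((\<lambda>t. \<Phi> (z + of_real s * e t)) has_vector_derivative
            (of_real s * (2 * of_real pi * \<i>) * e t) *\<^sub>C \<Phi>' (z + of_real s * e t)) (at t within {0..1})"
        by (simp add: has_vector_derivative_def scaleC.scaleR_left)
    qed simp
    moreover have "e 1 = e 0" by (simp add: e_def)
    ultimately have "integral (cbox 0 1) (\<lambda>t. (of_real s * (2 * of_real pi * \<i>)) *\<^sub>C
        e t *\<^sub>C \<Phi>' (z + of_real s * e t)) = 0"
      by (simp add: scaleC_scaleC integral_unique)
    then have "(of_real s * (2 * of_real pi * \<i>)) *\<^sub>C ?D s = 0"
      by (subst (asm) integral_linear[OF _ bounded_linear_scaleC, unfolded o_def])
        (auto intro!: integrable_continuous_real continuous_intros c2)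
    with that show ?thesis by (simp del: of_real_mult mult_eq_0_iff add: complex_vector.scale_eq_0_iff)
  qed
  \<comment> \<open>The endpoint 0 is an exceptional point handled by continuity; it is what ties
    the means to \<open>M 0\<close>, which equals \<open>\<Phi> z\<close>.\<close>
  have const: "M s = M 0" if "s \<ge> 0" for s
  proof (rule has_derivative_zero_unique_strong_interval[of "{0}" 0 s])
    show "continuous_on {0..s} M"
      by (meson dM continuous_at_imp_continuous_on has_vector_derivative_continuous)
    show "(M has_derivative (\<lambda>h. 0)) (at x within {0..s})"
      if "x \<in> {0..s} - {0}" for x
      using dM[of x] D0[of x] that
      by (auto simp: has_vector_derivative_def intro: has_derivative_at_withinI)
  qed (use that in auto)
  have "(\<lambda>n::nat. M (real n)) \<longlonglongrightarrow> 0"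
  proof (rule tendstoI)
    fix d :: real assume "d > 0"
    then obtain b where b: "\<And>x. b \<le> norm x \<Longrightarrow> dist (\<Phi> x) 0 < d / 2"
      using assms(2)[unfolded tendsto_iff eventually_at_infinity] by (meson half_gt_zero)
    have "dist (M (real n)) 0 < d" if "real n \<ge> b + norm z" for n
    proof -
      have "norm (\<Phi> (z + of_real (real n) * e t)) \<le> d / 2" for t
      proof -
        have "norm (of_real (real n) * e t) = real n" by (simp add: e_def norm_mult)
        then have "b \<le> norm (z + of_real (real n) * e t)"
          using that norm_triangle_ineq2[of "of_real (real n) * e t" "- z"] by (simp add: add.commute)
        then show ?thesis using b by (simp add: less_imp_le)
      qed
      then have "norm (M (real n)) \<le> integral (cbox 0 1) (\<lambda>t::real. d / 2)"
        unfolding M_def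
        by (intro integral_norm_bound_integral) (auto intro!: integrable_continuous_real continuous_intros c1)
      with \<open>d > 0\<close> show ?thesis by simp
    qed
    then show "\<forall>\<^sub>F n in sequentially. dist (M (real n)) 0 < d"
      by (rule eventually_mono[OF eventually_ge_at_top[of "nat \<lceil>b + norm z\<rceil>"], rotated]) linarith
  qed
  moreover have "(\<lambda>n::nat. M (real n)) = (\<lambda>_. M 0)"
    by (intro ext const) simp
  ultimately have "M 0 = 0" by (metis LIMSEQ_const_iff)
  then show ?thesis by (simp add: M_def)
qed

section \<open>Integrals along paths\<close>

text \<open>A valid path need not be rectifiable, so continuity of the integrand does not suffice for
  integrability; local primitives are used instead.\<close>

definition path_integrand :: "(real \<Rightarrow> complex) \<Rightarrow> (complex \<Rightarrow> 'b) \<Rightarrow> real \<Rightarrow> 'b::complex_banach" where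
  "path_integrand \<gamma> F = (\<lambda>s. vector_derivative \<gamma> (at s within {0..1}) *\<^sub>C F (\<gamma> s))"

definition path_integral :: "(real \<Rightarrow> complex) \<Rightarrow> (complex \<Rightarrow> 'b) \<Rightarrow> 'b::complex_banach" where
  "path_integral \<gamma> F = integral {0..1} (path_integrand \<gamma> F)"

definition segment_integral :: "(complex \<Rightarrow> 'b) \<Rightarrow> complex \<Rightarrow> complex \<Rightarrow> 'b::complex_banach" where
  "segment_integral F a b = integral {0..1} (\<lambda>t. (b - a) *\<^sub>C F (linepath a b t))"

lemma cauchy_integral_eq:
  "cauchy_integral \<Gamma> F = (1 / (2 * of_real pi * \<i>)) *\<^sub>C (\<Sum>\<gamma>\<leftarrow>\<Gamma>. path_integral \<gamma> F)"
  by (simp add: cauchy_integral_def path_integral_def path_integrand_def)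

text \<open>For the gauge integral, the fundamental theorem tolerates a finite set of exceptional
  points and yields integrability along with the value, even where the derivative of
  \<open>\<gamma>\<close> is unbounded.\<close>

lemma has_integral_path_primitive:
  assumes G: "\<And>z. z \<in> B \<Longrightarrow> (G has_derivative (\<lambda>h. h *\<^sub>C F z)) (at z)"
    and "valid_path \<gamma>" "0 \<le> a" "a \<le> b" "b \<le> 1" "\<gamma> ` {a..b} \<subseteq> B"
  shows "(path_integrand \<gamma> F has_integral (G (\<gamma> b) - G (\<gamma> a))) {a..b}"
proof -
  obtain S where S: "finite S" "\<And>t. t \<in> {0..1} - S \<Longrightarrow> \<gamma> differentiable at t"
    and cont: "continuous_on {0..1} \<gamma>"
    using assms(2) unfolding valid_path_def piecewise_C1_differentiable_on_def C1_differentiable_on_eq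
    by blast
  show ?thesis
    unfolding path_integrand_def
  proof (rule fundamental_theorem_of_calculus_interior_strong[OF S(1), where f = "\<lambda>s. G (\<gamma> s)"])
    fix x assume x: "x \<in> {a<..<b} - S"
    then have "\<gamma> differentiable at x" using S assms(3-5) by auto
    then have "(\<gamma> has_vector_derivative vector_derivative \<gamma> (at x)) (at x)"
      by (simp add: vector_derivative_works)
    moreover have "vector_derivative \<gamma> (at x) = vector_derivative \<gamma> (at x within {0..1})"
      using x assms(3-5) by (subst vector_derivative_at_within_ivl[OF vector_derivative_works[THEN iffD1, OF \<open>\<gamma> differentiable at x\<close>], of 0 1]) auto
    ultimately have D: "(\<gamma> has_derivative (\<lambda>h. h *\<^sub>R vector_derivative \<gamma> (at x within {0..1}))) (at x)"
      by (simp add: has_vector_derivative_def)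
    have "\<gamma> x \<in> B" using x assms(6) by auto
    from has_derivative_compose[OF D G[OF this]]
    show "((\<lambda>s. G (\<gamma> s)) has_vector_derivative
        vector_derivative \<gamma> (at x within {0..1}) *\<^sub>C F (\<gamma> x)) (at x)"
      by (simp add: has_vector_derivative_def scaleC.scaleR_left)
  next
    have "continuous_on B G"
      using G by (meson continuous_at_imp_continuous_on has_derivative_continuous)
    then show "continuous_on {a..b} (\<lambda>s. G (\<gamma> s))"
      by (rule continuous_on_compose2[OF _ continuous_on_subset[OF cont]]) (use assms in auto)
  qed (use assms in auto)
qed

lemma segment_integral_primitive:
  assumes "\<And>z. z \<in> B \<Longrightarrow> (G has_derivative (\<lambda>h. h *\<^sub>C F z)) (at z)" "closed_segment a b \<subseteq> B"
  shows "segment_integral F a b = G b - G a"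
proof -
  have eq: "path_integrand (linepath a b) F t = (b - a) *\<^sub>C F (linepath a b t)" if "t \<in> {0..1}" for t
    using that by (simp add: path_integrand_def vector_derivative_linepath_within)
  have "(path_integrand (linepath a b) F has_integral (G (linepath a b 1) - G (linepath a b 0))) {0..1}"
    by (rule has_integral_path_primitive[OF assms(1)]) (use assms(2) in \<open>simp_all add: linepath_image_01\<close>)
  then have "((\<lambda>t. (b - a) *\<^sub>C F (linepath a b t)) has_integral (G b - G a)) {0..1}"
    by (subst has_integral_cong[OF eq[symmetric]]) (auto simp: linepath_def)
  then show ?thesis by (simp add: segment_integral_def integral_unique)
qed

section \<open>Polygons inscribed in a path\<close>

definition vertex :: "(real \<Rightarrow> complex) \<Rightarrow> nat \<Rightarrow> nat \<Rightarrow> complex" where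
  "vertex \<gamma> m k = \<gamma> (real k / real m)"

text \<open>A single ball contains a piece of the path and, being convex, also the chord of that
  piece.\<close>

definition fine_partition :: "(real \<Rightarrow> complex) \<Rightarrow> real \<Rightarrow> nat \<Rightarrow> bool" where
  "fine_partition \<gamma> e m \<longleftrightarrow> e > 0 \<and> m > 0 \<and>
     (\<forall>k<m. \<gamma> ` {real k / real m .. real (Suc k) / real m} \<subseteq> ball (vertex \<gamma> m k) e)"

lemma vertex_Suc_in_ball: "fine_partition \<gamma> e m \<Longrightarrow> k < m \<Longrightarrow> vertex \<gamma> m (Suc k) \<in> ball (vertex \<gamma> m k) e"
proof -
  assume "fine_partition \<gamma> e m" "k < m"
  moreover from this have "real (Suc k) / real m \<in> {real k / real m .. real (Suc k) / real m}"
    by (auto simp: divide_right_mono)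
  ultimately show ?thesis
    unfolding fine_partition_def vertex_def by (meson image_subset_iff)
qed

lemma segment_subset_ball:
  "fine_partition \<gamma> e m \<Longrightarrow> k < m \<Longrightarrow>
    closed_segment (vertex \<gamma> m k) (vertex \<gamma> m (Suc k)) \<subseteq> ball (vertex \<gamma> m k) e"
  using vertex_Suc_in_ball by (intro closed_segment_subset) (auto simp: fine_partition_def)

text \<open>Inside each ball a primitive exists, so the piece of the path and its chord have the
  same integral. On chords the integrand is continuous over a compact interval, which permits
  differentiation with respect to a parameter.\<close>

lemma has_integral_polygon:
  assumes "valid_path \<gamma>" "fine_partition \<gamma> e m"
    and "C1_holomorphic F (\<Union>k<m. ball (vertex \<gamma> m k) e)"
  shows "(path_integrand \<gamma> F has_integral
      (\<Sum>k<m. segment_integral F (vertex \<gamma> m k) (vertex \<gamma> m (Suc k)))) {0..1}"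
proof -
  have m: "m > 0" using assms(2) by (simp add: fine_partition_def)
  have piece: "(path_integrand \<gamma> F has_integral segment_integral F (vertex \<gamma> m k) (vertex \<gamma> m (Suc k)))
      {real k / real m .. real (Suc k) / real m}" if "k < m" for k
  proof -
    have "C1_holomorphic F (ball (vertex \<gamma> m k) e)"
      using assms(3) by (rule C1_holomorphic_subset) (use that in auto)
    then obtain G where G: "\<And>z. z \<in> ball (vertex \<gamma> m k) e \<Longrightarrow> (G has_derivative (\<lambda>h. h *\<^sub>C F z)) (at z)"
      by (rule C1_holomorphic_primitive) blast
    have "\<gamma> ` {real k / real m .. real (Suc k) / real m} \<subseteq> ball (vertex \<gamma> m k) e"
      using that assms(2) unfolding fine_partition_def by blast
    note img = this
    have "(path_integrand \<gamma> F has_integral (G (\<gamma> (real (Suc k) / real m)) - G (\<gamma> (real k / real m))))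
        {real k / real m .. real (Suc k) / real m}"
      by (rule has_integral_path_primitive[OF G assms(1) _ _ _ img])
        (use that in \<open>simp_all add: divide_right_mono\<close>)
    moreover have "segment_integral F (vertex \<gamma> m k) (vertex \<gamma> m (Suc k))
        = G (vertex \<gamma> m (Suc k)) - G (vertex \<gamma> m k)"
      using G segment_subset_ball[OF assms(2) that] by (rule segment_integral_primitive)
    ultimately show ?thesis by (simp add: vertex_def)
  qed
  have "(path_integrand \<gamma> F has_integral
      (\<Sum>k<j. segment_integral F (vertex \<gamma> m k) (vertex \<gamma> m (Suc k)))) {0..real j / real m}"
    if "j \<le> m" for j
    using that
  proof (induction j)
    case (Suc j)
    then show ?case
      using has_integral_combine[OF _ _ Suc.IH piece[of j]] by (simp add: divide_right_mono)
  qed (simp add: has_integral_refl)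
  from this[of m] m show ?thesis by simp
qed

lemma path_integral_polygon:
  assumes "valid_path \<gamma>" "fine_partition \<gamma> e m"
    and "C1_holomorphic F (\<Union>k<m. ball (vertex \<gamma> m k) e)"
  shows "path_integral \<gamma> F = (\<Sum>k<m. segment_integral F (vertex \<gamma> m k) (vertex \<gamma> m (Suc k)))"
  unfolding path_integral_def by (rule integral_unique[OF has_integral_polygon[OF assms]])

text \<open>Uniform continuity of \<open>\<gamma>\<close> gives the partition. Closed balls are kept
  inside \<open>U\<close> because their union later enters a compact set outside which a Cauchy
  transform is holomorphic.\<close>

lemma fine_partition_exists:
  assumes "path \<gamma>" "path_image \<gamma> \<subseteq> U" "open U"
  obtains e m where "fine_partition \<gamma> e m" "(\<Union>k<m. cball (vertex \<gamma> m k) e) \<subseteq> U"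
proof -
  obtain e where e: "e > 0" "(\<Union>x\<in>path_image \<gamma>. cball x e) \<subseteq> U"
    using compact_subset_open_imp_cball_epsilon_subset[OF compact_path_image[OF assms(1)] assms(3,2)] .
  have "uniformly_continuous_on {0..1} \<gamma>"
    using assms(1) by (simp add: path_def compact_uniformly_continuous)
  then obtain d where d: "d > 0"
    "\<And>x y. x \<in> {0..1} \<Longrightarrow> y \<in> {0..1} \<Longrightarrow> dist y x < d \<Longrightarrow> dist (\<gamma> y) (\<gamma> x) < e"
    using e(1) unfolding uniformly_continuous_on_def by metis
  obtain m :: nat where m: "m > 0" "1 / real m < d"
    using d(1) by (metis nat_approx_posE of_nat_0_less_iff zero_less_Suc)
  have in01: "real k / real m \<in> {0..1}" if "k \<le> m" for k using that m by auto
  have "\<gamma> ` {real k / real m .. real (Suc k) / real m} \<subseteq> ball (vertex \<gamma> m k) e" if "k < m" for k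
  proof
    fix w assume "w \<in> \<gamma> ` {real k / real m .. real (Suc k) / real m}"
    then obtain t where t: "w = \<gamma> t" "real k / real m \<le> t" "t \<le> real (Suc k) / real m" by auto
    have "0 \<le> real k / real m" "real (Suc k) / real m \<le> 1"
      using in01[of "Suc k"] in01[of k] that by auto
    then have "t \<in> {0..1}" using t unfolding atLeastAtMost_iff by linarith
    moreover have "real (Suc k) / real m = real k / real m + 1 / real m" by (simp add: add_divide_distrib)
    then have "dist (real k / real m) t < d" using t m by (simp add: dist_real_def)
    ultimately show "w \<in> ball (vertex \<gamma> m k) e"
      using d(2)[of t "real k / real m"] in01[of k] that t by (simp add: vertex_def)
  qed
  then have "fine_partition \<gamma> e m" using e(1) m(1) by (simp add: fine_partition_def)
  moreover have "vertex \<gamma> m k \<in> path_image \<gamma>" if "k < m" for k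
    using in01[of k] that by (auto simp: vertex_def path_image_def)
  ultimately show ?thesis using that e(2) by blast
qed

lemma path_integrand_integrable:
  assumes "valid_path \<gamma>" "path_image \<gamma> \<subseteq> U" "open U" "C1_holomorphic F U"
  shows "path_integrand \<gamma> F integrable_on {0..1}"
proof -
  obtain e m where em: "fine_partition \<gamma> e m" "(\<Union>k<m. cball (vertex \<gamma> m k) e) \<subseteq> U"
    using fine_partition_exists[OF valid_path_imp_path[OF assms(1)] assms(2,3)] .
  then have "(\<Union>k<m. ball (vertex \<gamma> m k) e) \<subseteq> U" by (meson SUP_mono ball_subset_cball order_trans)
  then show ?thesis
    using has_integral_polygon[OF assms(1) em(1) C1_holomorphic_subset[OF assms(4)]] by blast
qed

lemma path_integral_linear:
  assumes "path_integrand \<gamma> F integrable_on {0..1}" "bounded_linear L" "\<And>c x. L (c *\<^sub>C x) = c *\<^sub>C L x"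
  shows "path_integral \<gamma> (\<lambda>z. L (F z)) = L (path_integral \<gamma> F)"
  using integral_linear[OF assms(1,2)] by (simp add: path_integral_def path_integrand_def assms(3) o_def)

lemma cauchy_integral_linear:
  assumes "\<And>\<gamma>. \<gamma> \<in> set \<Gamma> \<Longrightarrow> path_integrand \<gamma> F integrable_on {0..1}" "bounded_linear L"
    "\<And>c x. L (c *\<^sub>C x) = c *\<^sub>C L x"
  shows "cauchy_integral \<Gamma> (\<lambda>z. L (F z)) = L (cauchy_integral \<Gamma> F)"
proof -
  interpret L: bounded_linear L by fact
  have "(\<Sum>\<gamma>\<leftarrow>\<Gamma>. path_integral \<gamma> (\<lambda>z. L (F z))) = L (\<Sum>\<gamma>\<leftarrow>\<Gamma>. path_integral \<gamma> F)"
    using assms(1) by (induction \<Gamma>) (auto simp: L.zero L.add path_integral_linear[OF _ assms(2,3)])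
  then show ?thesis by (simp add: cauchy_integral_eq assms(3))
qed

lemma cauchy_integral_sum:
  assumes "\<And>\<gamma> i. \<gamma> \<in> set \<Gamma> \<Longrightarrow> i \<in> I \<Longrightarrow> path_integrand \<gamma> (F i) integrable_on {0..1}"
  shows "cauchy_integral \<Gamma> (\<lambda>z. \<Sum>i\<in>I. F i z) = (\<Sum>i\<in>I. cauchy_integral \<Gamma> (F i))"
proof (cases "finite I")
  case True
  have "path_integral \<gamma> (\<lambda>z. \<Sum>i\<in>I. F i z) = (\<Sum>i\<in>I. path_integral \<gamma> (F i))" if "\<gamma> \<in> set \<Gamma>" for \<gamma>
    using integral_sum[OF True assms[OF that]]
    by (simp add: path_integral_def path_integrand_def scaleC.sum_right)
  then have "(\<Sum>\<gamma>\<leftarrow>\<Gamma>. path_integral \<gamma> (\<lambda>z. \<Sum>i\<in>I. F i z)) = (\<Sum>\<gamma>\<leftarrow>\<Gamma>. \<Sum>i\<in>I. path_integral \<gamma> (F i))"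
    by (auto intro: arg_cong[of _ _ sum_list])
  also have "\<dots> = (\<Sum>i\<in>I. \<Sum>\<gamma>\<leftarrow>\<Gamma>. path_integral \<gamma> (F i))"
    by (induction \<Gamma>) (simp_all add: sum.distrib)
  finally show ?thesis by (simp add: cauchy_integral_eq scaleC.sum_right)
next
  \<comment> \<open>Sums over an infinite index set are 0, so both sides vanish.\<close>
  case False
  have "(\<Sum>\<gamma>\<leftarrow>\<Gamma>. 0) = (0::'b)" by (induction \<Gamma>) auto
  with False show ?thesis by (simp add: cauchy_integral_eq path_integral_def path_integrand_def)
qed

lemma cauchy_integral_cong:
  assumes "\<And>\<gamma> z. \<gamma> \<in> set \<Gamma> \<Longrightarrow> z \<in> path_image \<gamma> \<Longrightarrow> F z = G z"
  shows "cauchy_integral \<Gamma> F = cauchy_integral \<Gamma> G"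
  unfolding cauchy_integral_def
  by (intro arg_cong[of _ _ "\<lambda>xs. _ *\<^sub>C sum_list xs"] map_cong integral_cong)
    (auto simp: assms path_image_def)

lemma path_integral_complex:
  fixes F :: "complex \<Rightarrow> complex"
  assumes "(F has_contour_integral I) \<gamma>"
  shows "path_integral \<gamma> F = I"
  using assms unfolding has_contour_integral_def path_integral_def path_integrand_def
  by (simp add: scaleC_complex_eq integral_unique mult.commute)

section \<open>Cauchy transforms of segments\<close>

text \<open>Differentiation with respect to \<open>z\<close> hits only the kernel
  \<open>1 / (w - z)\<close>, which is smooth off the segment; \<open>F\<close> itself just has to
  be continuous.\<close>

lemma C1_holomorphic_cauchy_transform:
  fixes F :: "complex \<Rightarrow> 'b::complex_banach"
  assumes "continuous_on (closed_segment a b) F"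
  shows "C1_holomorphic (\<lambda>z. segment_integral (\<lambda>w. (1 / (w - z)) *\<^sub>C F w) a b) (- closed_segment a b)"
proof -
  let ?U = "- closed_segment a b" and ?l = "linepath a b"
  have l: "?l t \<in> closed_segment a b" if "t \<in> cbox 0 1" for t
    using that linepath_image_01[of a b] by (metis box_real(2) imageI)
  have cl [continuous_intros]: "continuous_on S (\<lambda>x. ?l (f x))" if "continuous_on S f"
    for S and f :: "complex \<times> real \<Rightarrow> real"
    unfolding linepath_def using that by (intro continuous_intros)
  have cF: "continuous_on (?U \<times> cbox 0 1) (\<lambda>x. F (?l (snd x)))"
    by (rule continuous_on_compose2[OF assms]) (auto intro!: continuous_intros simp: l simp del: box_real)
  have ne: "?l t - z \<noteq> 0" if "z \<in> ?U" "t \<in> cbox 0 1" for z t using that l[of t] by auto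
  define D where "D z t = ((b - a) * (1 / (?l t - z)\<^sup>2)) *\<^sub>C F (?l t)" for z t
  have cD: "continuous_on (?U \<times> cbox 0 1) (\<lambda>x. D (fst x) (snd x))"
    unfolding D_def using ne by (intro continuous_intros cF) (auto simp del: box_real)
  have cf: "continuous_on (?U \<times> cbox 0 1) (\<lambda>x. (b - a) *\<^sub>C (1 / (?l (snd x) - fst x)) *\<^sub>C F (?l (snd x)))"
    using ne by (intro continuous_intros cF) (auto simp del: box_real)
  have slice: "continuous_on (cbox 0 1) (\<lambda>t. K z t)"
    if "continuous_on (?U \<times> cbox 0 1) (\<lambda>x. K (fst x) (snd x))" "z \<in> ?U"
    for K :: "complex \<Rightarrow> real \<Rightarrow> 'b" and z
    by (rule continuous_on_compose2[OF that(1), where f = "\<lambda>t. (z, t)", simplified])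
      (use that(2) in \<open>auto intro!: continuous_intros\<close>)
  define H where "H z = integral (cbox 0 1) (\<lambda>t. (b - a) *\<^sub>C (1 / (?l t - z)) *\<^sub>C F (?l t))" for z
  have "(H has_derivative (\<lambda>h. h *\<^sub>C integral (cbox 0 1) (D z))) (at z)" if z: "z \<in> ?U" for z
  proof -
    \<comment> \<open>The Leibniz rule is applied on a ball, since the complement of a segment is
      not convex in general.\<close>
    obtain r where r: "r > 0" "ball z r \<subseteq> ?U"
      using z open_contains_ball[of ?U] by (metis closed_segment open_Compl)
    have "(H has_derivative integral (cbox 0 1) (\<lambda>t. scaleC.prod_left (D z t))) (at z within ball z r)"
      unfolding H_def
    proof (rule leibniz_rule)
      fix z' t assume zt: "z' \<in> ball z r" "t \<in> cbox 0 (1::real)"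
      then have ne': "?l t - z' \<noteq> 0" using r ne by blast
      then have "((\<lambda>z. 1 / (?l t - z)) has_field_derivative 1 / (?l t - z')\<^sup>2) (at z')"
        by (auto intro!: derivative_eq_intros simp: power2_eq_square)
      then have "((\<lambda>z. 1 / (?l t - z)) has_derivative (\<lambda>h. h * (1 / (?l t - z')\<^sup>2))) (at z' within ball z r)"
        unfolding has_field_derivative_def
        by (rule has_derivative_eq_rhs[OF has_derivative_at_withinI]) (simp add: fun_eq_iff)
      from bounded_linear.has_derivative[OF bounded_linear_scaleC
          bounded_linear.has_derivative[OF scaleC.bounded_linear_left this]]
      show "((\<lambda>z. (b - a) *\<^sub>C (1 / (?l t - z)) *\<^sub>C F (?l t)) has_derivative
              blinfun_apply (scaleC.prod_left (D z' t))) (at z' within ball z r)"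
        by (rule has_derivative_eq_rhs) (simp add: D_def scaleC_scaleC fun_eq_iff mult.commute mult.left_commute)
    next
      fix z' assume "z' \<in> ball z r"
      then show "(\<lambda>t. (b - a) *\<^sub>C (1 / (?l t - z')) *\<^sub>C F (?l t)) integrable_on cbox 0 1"
        using r by (intro integrable_continuous slice[OF cf]) auto
    next
      show "continuous_on (ball z r \<times> cbox 0 1) (\<lambda>(z, t). scaleC.prod_left (D z t))"
        using bounded_linear.continuous_on[OF scaleC.bounded_linear_prod_left
            continuous_on_subset[OF cD, of "ball z r \<times> cbox 0 1"]] r(2)
        by (auto simp: split_beta)
    qed (use r in auto)
    moreover have "integral (cbox 0 1) (\<lambda>t. scaleC.prod_left (D z t))
        = scaleC.prod_left (integral (cbox 0 1) (D z))"
      using integral_linear[OF integrable_continuous[OF slice[OF cD z]] scaleC.bounded_linear_prod_left]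
      by (simp add: o_def)
    ultimately show ?thesis
      using r(1) by (simp add: at_within_open[OF _ open_ball])
  qed
  moreover have "continuous_on ?U (\<lambda>z. integral (cbox 0 1) (D z))"
    by (rule integral_continuous_on_param) (use cD in \<open>simp add: split_beta\<close>)
  ultimately show ?thesis
    unfolding C1_holomorphic_def segment_integral_def H_def by (auto simp: H_def)
qed

lemma cauchy_transform_tendsto_0:
  fixes F :: "complex \<Rightarrow> 'b::complex_banach"
  assumes "continuous_on (closed_segment a b) F"
  shows "((\<lambda>z. segment_integral (\<lambda>w. (1 / (w - z)) *\<^sub>C F w) a b) \<longlongrightarrow> 0) at_infinity"
proof -
  let ?l = "linepath a b"
  have l: "?l t \<in> closed_segment a b" if "t \<in> {0..1}" for t
    using that linepath_image_01[of a b] by (metis imageI)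
  obtain M where M: "M > 0" "\<And>w. w \<in> closed_segment a b \<Longrightarrow> norm w \<le> M"
    using compact_imp_bounded[OF compact_segment, of a b] unfolding bounded_pos by auto
  obtain C where C: "\<And>w. w \<in> closed_segment a b \<Longrightarrow> norm (F w) \<le> C"
    using compact_imp_bounded[OF compact_continuous_image[OF assms compact_segment]]
    unfolding bounded_pos by auto
  have cF: "continuous_on {0..1} (\<lambda>t. F (?l t))"
    by (rule continuous_on_compose2[OF assms]) (auto intro!: continuous_intros simp: l)
  show ?thesis
  proof (rule Lim_null_comparison[where g = "\<lambda>z. norm (b - a) * C / (norm z - M)"])
    have "norm (segment_integral (\<lambda>w. (1 / (w - z)) *\<^sub>C F w) a b) \<le> norm (b - a) * C / (norm z - M)"
      if z: "M + 1 \<le> norm z" for z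
    proof -
      have d: "norm z - M \<le> norm (?l t - z)" "?l t - z \<noteq> 0" if "t \<in> {0..1}" for t
        using M(2)[OF l[OF that]] z norm_triangle_ineq2[of z "?l t"] by (auto simp: norm_minus_commute)
      have "norm ((b - a) *\<^sub>C (1 / (?l t - z)) *\<^sub>C F (?l t)) \<le> norm (b - a) * C / (norm z - M)"
        if "t \<in> {0..1}" for t
      proof -
        have "norm (1 / (?l t - z)) * norm (F (?l t)) \<le> 1 / (norm z - M) * C"
          using d[OF that] z C[OF l[OF that]]
          by (intro mult_mono) (auto simp: norm_divide intro!: divide_left_mono mult_pos_pos)
        then show ?thesis
          unfolding norm_scaleC by (metis mult.assoc mult_left_mono norm_ge_zero times_divide_eq_left times_divide_eq_right mult.left_neutral mult.commute)
      qed
      then have "norm (segment_integral (\<lambda>w. (1 / (w - z)) *\<^sub>C F w) a b)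
          \<le> integral {0..1} (\<lambda>t::real. norm (b - a) * C / (norm z - M))"
        unfolding segment_integral_def using d
        by (intro integral_norm_bound_integral integrable_continuous_real continuous_intros cF) auto
      then show ?thesis by simp
    qed
    then show "\<forall>\<^sub>F z in at_infinity. norm (segment_integral (\<lambda>w. (1 / (w - z)) *\<^sub>C F w) a b)
        \<le> norm (b - a) * C / (norm z - M)"
      unfolding eventually_at_infinity by blast
    have "filterlim (\<lambda>z::complex. - M + norm z) at_top at_infinity"
      by (rule filterlim_tendsto_add_at_top[OF tendsto_const filterlim_norm_at_top])
    then show "((\<lambda>z::complex. norm (b - a) * C / (norm z - M)) \<longlongrightarrow> 0) at_infinity"
      by (intro tendsto_divide_0[OF tendsto_const] filterlim_at_top_imp_at_infinity) simp
  qed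
qed

section \<open>Complex linear operators and resolvents\<close>

abbreviation (input) id_op :: "'a::complex_banach \<Rightarrow>\<^sub>L 'a" where "id_op \<equiv> id_blinfun"

definition clin :: "('a::complex_banach \<Rightarrow>\<^sub>L 'a) \<Rightarrow> bool" where
  "clin T \<longleftrightarrow> (\<forall>c x. blinfun_apply T (c *\<^sub>C x) = c *\<^sub>C blinfun_apply T x)"

lemma clin_iff_linear:
  "clin T \<longleftrightarrow> Vector_Spaces.linear scaleC scaleC (blinfun_apply (T :: 'a::complex_banach \<Rightarrow>\<^sub>L 'a))"
  by (auto simp: clin_def Vector_Spaces.linear_iff blinfun.add_right
      complex_vector.vector_space_axioms)

lemma blinfun_compose_scaleC_left [simp]: "(c *\<^sub>C S) o\<^sub>L T = c *\<^sub>C (S o\<^sub>L T)"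
  by (rule blinfun_eqI) (simp add: scaleC_blinfun.rep_eq)

text \<open>Elements of the operator type are only real linear, so a complex scalar passes through
  the left factor only if that factor is complex linear.\<close>

lemma blinfun_compose_scaleC_right: "clin S \<Longrightarrow> S o\<^sub>L (c *\<^sub>C T) = c *\<^sub>C (S o\<^sub>L T)"
  by (rule blinfun_eqI) (simp add: scaleC_blinfun.rep_eq clin_def)

lemmas blinfun_compose_distrib =
  bounded_bilinear.add_left[OF bounded_bilinear_blinfun_compose]
  bounded_bilinear.add_right[OF bounded_bilinear_blinfun_compose]
  bounded_bilinear.diff_left[OF bounded_bilinear_blinfun_compose]
  bounded_bilinear.diff_right[OF bounded_bilinear_blinfun_compose]
  bounded_bilinear.minus_left[OF bounded_bilinear_blinfun_compose]
  bounded_bilinear.minus_right[OF bounded_bilinear_blinfun_compose]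

lemmas bounded_linear_compose_left = bounded_bilinear.bounded_linear_left[OF bounded_bilinear_blinfun_compose]
lemmas bounded_linear_compose_right = bounded_bilinear.bounded_linear_right[OF bounded_bilinear_blinfun_compose]
lemmas compose_sum_left = bounded_bilinear.sum_left[OF bounded_bilinear_blinfun_compose]
lemmas compose_sum_right = bounded_bilinear.sum_right[OF bounded_bilinear_blinfun_compose]

lemma blinfun_compose_id [simp]: "id_op o\<^sub>L T = T" "T o\<^sub>L id_op = T"
  by (auto intro: blinfun_eqI)

lemma blinfun_compose_assoc: "(R o\<^sub>L S) o\<^sub>L T = R o\<^sub>L (S o\<^sub>L T)"
  by (rule blinfun_eqI) simp

lemma clin_intros:
  "clin id_op" "clin 0"
  "clin S \<Longrightarrow> clin T \<Longrightarrow> clin (S o\<^sub>L T)"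
  "clin S \<Longrightarrow> clin T \<Longrightarrow> clin (S + T)"
  "clin S \<Longrightarrow> clin T \<Longrightarrow> clin (S - T)"
  "clin S \<Longrightarrow> clin (c *\<^sub>C S)"
  by (simp_all add: clin_def blinfun.bilinear_simps scaleC_add_right scaleC.diff_right
      scaleC_blinfun.rep_eq scaleC_scaleC mult.commute)

lemma clin_sum: "(\<And>i. i \<in> I \<Longrightarrow> clin (T i)) \<Longrightarrow> clin (\<Sum>i\<in>I. T i)"
  by (induction I rule: infinite_finite_induct) (auto intro: clin_intros)

lemma closed_clin: "closed {T :: 'a::complex_banach \<Rightarrow>\<^sub>L 'a. clin T}"
  unfolding clin_def
  by (intro closed_Collect_all closed_Collect_eq continuous_intros
      bounded_linear.continuous_on[OF bounded_linear_scaleC])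

definition op_inverse :: "('a::complex_banach \<Rightarrow>\<^sub>L 'a) \<Rightarrow> ('a \<Rightarrow>\<^sub>L 'a) \<Rightarrow> bool" where
  "op_inverse S T \<longleftrightarrow> S o\<^sub>L T = id_op \<and> T o\<^sub>L S = id_op"

lemma op_inverse_unique: "op_inverse S T \<Longrightarrow> op_inverse S' T \<Longrightarrow> S = S'"
  unfolding op_inverse_def by (metis blinfun_compose_assoc blinfun_compose_id)

text \<open>Stated abstractly so that one development serves both the complex linear operators,
  which give the spectrum, and the lower triangular ones, which give the causal spectrum.\<close>

locale operator_algebra =
  fixes \<A> :: "('a::complex_banach \<Rightarrow>\<^sub>L 'a) set"
  assumes clin_mem: "T \<in> \<A> \<Longrightarrow> clin T"
    and id_mem: "id_op \<in> \<A>"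
    and add_mem: "S \<in> \<A> \<Longrightarrow> T \<in> \<A> \<Longrightarrow> S + T \<in> \<A>"
    and scale_mem: "S \<in> \<A> \<Longrightarrow> c *\<^sub>C S \<in> \<A>"
    and comp_mem: "S \<in> \<A> \<Longrightarrow> T \<in> \<A> \<Longrightarrow> S o\<^sub>L T \<in> \<A>"
    and closed_mem: "closed \<A>"
begin

lemma neumann:
  assumes "T \<in> \<A>" "norm T < 1"
  obtains S where "S \<in> \<A>" "op_inverse S (id_op - T)"
proof -
  define p where "p k = (((o\<^sub>L) T) ^^ k) id_op" for k
  have p_Suc: "p (Suc k) = T o\<^sub>L p k" and p0: "p 0 = id_op" for k by (simp_all add: p_def)
  have comm: "p k o\<^sub>L T = T o\<^sub>L p k" for k
    by (induction k) (simp_all add: p0 p_Suc blinfun_compose_assoc)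
  have p_mem: "p k \<in> \<A>" for k
    by (induction k) (simp_all add: p0 p_Suc id_mem comp_mem assms)
  have "norm (p k) \<le> norm (id_op :: 'a \<Rightarrow>\<^sub>L 'a) * norm T ^ k" for k
  proof (induction k)
    case (Suc k)
    have "norm (p (Suc k)) \<le> norm T * norm (p k)" unfolding p_Suc by (rule norm_blinfun_compose)
    also have "\<dots> \<le> norm T * (norm (id_op :: 'a \<Rightarrow>\<^sub>L 'a) * norm T ^ k)"
      using Suc by (rule mult_left_mono) simp
    finally show ?case by (simp add: mult_ac)
  qed (simp add: p0)
  then have sum: "summable p"
    by (rule summable_comparison_test'[rotated, of 0])
      (use assms(2) in \<open>simp add: summable_geometric summable_mult\<close>)
  have "(\<lambda>n. \<Sum>k<n. p k) \<longlonglongrightarrow> suminf p" using sum by (rule summable_LIMSEQ)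
  \<comment> \<open>The empty sum is the identity scaled by 0, hence in the algebra.\<close>
  moreover have "(\<Sum>k<n. p k) \<in> \<A>" for n
    using scale_mem[OF id_mem, of 0] by (induction n) (auto intro: add_mem p_mem)
  ultimately have "suminf p \<in> \<A>" using closed_mem by (meson closed_sequentially)
  have tail: "(\<Sum>k. T o\<^sub>L p k) = suminf p - id_op"
    using suminf_split_head[OF sum] by (simp add: p_Suc p0)
  have "T o\<^sub>L suminf p = suminf p - id_op"
    using bounded_linear.suminf[OF bounded_linear_compose_right sum, of T] tail by simp
  moreover have "suminf p o\<^sub>L T = suminf p - id_op"
    using bounded_linear.suminf[OF bounded_linear_compose_left sum, of T] tail by (simp add: comm)
  ultimately have "op_inverse (suminf p) (id_op - T)"
    by (simp add: op_inverse_def blinfun_compose_distrib)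
  with \<open>suminf p \<in> \<A>\<close> show ?thesis by (rule that)
qed

definition resolvent_set :: "('a \<Rightarrow>\<^sub>L 'a) \<Rightarrow> complex set" where
  "resolvent_set B = {z. \<exists>S\<in>\<A>. op_inverse S (z *\<^sub>C id_op - B)}"

text \<open>Factor \<open>w - B\<close> as \<open>(z - B) (1 - (z - w) S)\<close>. The Neumann
  series inverts the second factor inside the algebra, so \<open>N o S\<close> is the inverse
  sought.\<close>

lemma resolvent_set_perturb:
  assumes "clin B" "S \<in> \<A>" "op_inverse S (z *\<^sub>C id_op - B)" "cmod (z - w) * norm S < 1"
  shows "w \<in> resolvent_set B"
proof -
  have "norm ((z - w) *\<^sub>C S) < 1" using assms(4) by (simp add: norm_scaleC)
  then obtain N where N: "N \<in> \<A>" "op_inverse N (id_op - (z - w) *\<^sub>C S)"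
    using neumann[OF scale_mem[OF assms(2)]] by blast
  let ?M = "id_op - (z - w) *\<^sub>C S"
  have w: "w *\<^sub>C id_op - B = (z *\<^sub>C id_op - B) - (z - w) *\<^sub>C id_op"
    by (simp add: scaleC.diff_left)
  have 1: "S o\<^sub>L (w *\<^sub>C id_op - B) = ?M"
    using assms(3) unfolding w
    by (simp add: op_inverse_def blinfun_compose_distrib(4)[of S "z *\<^sub>C id_op - B"]
        blinfun_compose_scaleC_right[OF clin_mem[OF assms(2)]])
  have 2: "w *\<^sub>C id_op - B = (z *\<^sub>C id_op - B) o\<^sub>L ?M"
    using assms(3) unfolding w
    by (simp add: op_inverse_def blinfun_compose_distrib(4)[of "z *\<^sub>C id_op - B"]
        blinfun_compose_scaleC_right clin_intros assms(1))
  have "(N o\<^sub>L S) o\<^sub>L (w *\<^sub>C id_op - B) = id_op"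
    using N(2) 1 by (simp add: blinfun_compose_assoc op_inverse_def)
  moreover have "(w *\<^sub>C id_op - B) o\<^sub>L (N o\<^sub>L S) = id_op"
    using N(2) assms(3) unfolding 2 op_inverse_def by (metis blinfun_compose_assoc blinfun_compose_id)
  ultimately show ?thesis
    unfolding resolvent_set_def op_inverse_def using N(1) assms(2) comp_mem by blast
qed

lemma open_resolvent_set:
  assumes "clin B" shows "open (resolvent_set B)"
proof (rule openI)
  fix z assume "z \<in> resolvent_set B"
  then obtain S where S: "S \<in> \<A>" "op_inverse S (z *\<^sub>C id_op - B)"
    by (auto simp: resolvent_set_def)
  \<comment> \<open>The summand 1 keeps the radius meaningful when \<open>S = 0\<close>, as happens
    on the zero space.\<close>
  have "ball z (1 / (norm S + 1)) \<subseteq> resolvent_set B"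
  proof
    fix w assume "w \<in> ball z (1 / (norm S + 1))"
    then have "cmod (z - w) * (norm S + 1) < 1"
      using less_divide_eq[of "cmod (z - w)" 1 "norm S + 1"] by (simp add: dist_norm add_nonneg_pos)
    then have "cmod (z - w) * norm S < 1"
      by (smt (verit) mult_left_mono norm_ge_zero)
    then show "w \<in> resolvent_set B" by (rule resolvent_set_perturb[OF assms S])
  qed
  moreover have "1 / (norm S + 1) > 0" by (simp add: add_nonneg_pos)
  ultimately show "\<exists>e>0. ball z e \<subseteq> resolvent_set B" by blast
qed

text \<open>Write \<open>z - B = z (1 - B / z)\<close> and use the Neumann series. For lower
  triangular \<open>B\<close> this bounds the causal spectrum and provides a starting point on the
  imaginary axis.\<close>

lemma resolvent_set_large:
  assumes "B \<in> \<A>" "norm B < cmod z" shows "z \<in> resolvent_set B"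
proof -
  have z: "z \<noteq> 0" using assms(2) by (metis norm_ge_zero norm_zero not_less)
  then have "norm ((1 / z) *\<^sub>C B) < 1"
    using assms(2) by (simp add: norm_scaleC norm_divide)
  then obtain N where N: "N \<in> \<A>" "op_inverse N (id_op - (1 / z) *\<^sub>C B)"
    using neumann[OF scale_mem[OF assms(1)]] by blast
  have eq: "z *\<^sub>C id_op - B = z *\<^sub>C (id_op - (1 / z) *\<^sub>C B)"
    using z by (simp add: scaleC.diff_right scaleC_scaleC scaleC_one)
  have "op_inverse ((1 / z) *\<^sub>C N) (z *\<^sub>C id_op - B)"
    unfolding eq using N(2) z
    by (simp add: op_inverse_def blinfun_compose_scaleC_right clin_mem[OF N(1)] scaleC_scaleC scaleC_one
        clin_intros clin_mem[OF assms(1)])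
  then show ?thesis using scale_mem[OF N(1)] by (auto simp: resolvent_set_def)
qed

end

interpretation clin: operator_algebra "{T :: 'a::complex_banach \<Rightarrow>\<^sub>L 'a. clin T}"
  by unfold_locales (auto intro: clin_intros closed_clin)

text \<open>Uniqueness holds among all bounded real linear operators, so the value does not depend
  on the algebra in which an inverse is sought.\<close>

definition res :: "('a::complex_banach \<Rightarrow>\<^sub>L 'a) \<Rightarrow> complex \<Rightarrow> 'a \<Rightarrow>\<^sub>L 'a" where
  "res B z = (THE S. op_inverse S (z *\<^sub>C id_op - B))"

lemma res_eqI: "op_inverse S (z *\<^sub>C id_op - B) \<Longrightarrow> res B z = S"
  unfolding res_def using op_inverse_unique by blast

lemma res_inverse:
  assumes "z \<in> clin.resolvent_set B"
  shows "op_inverse (res B z) (z *\<^sub>C id_op - B)" "clin (res B z)"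
  using assms res_eqI by (auto simp: clin.resolvent_set_def)

text \<open>This reduces the comparison of the two spectra to membership of one function's values in
  the algebra. The inclusion of the spectrum in the causal spectrum is an immediate
  consequence.\<close>

lemma (in operator_algebra) resolvent_set_iff:
  "z \<in> resolvent_set B \<longleftrightarrow> z \<in> clin.resolvent_set B \<and> res B z \<in> \<A>"
  using res_eqI res_inverse clin_mem by (fastforce simp: resolvent_set_def clin.resolvent_set_def)

lemma res_identity:
  assumes "z \<in> clin.resolvent_set B" "w \<in> clin.resolvent_set B"
  shows "res B w - res B z = (z - w) *\<^sub>C (res B w o\<^sub>L res B z)"
proof -
  note z = res_inverse[OF assms(1)] and w = res_inverse[OF assms(2)]
  have "res B w o\<^sub>L ((z *\<^sub>C id_op - B) o\<^sub>L res B z) = res B w"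
    using z by (simp add: op_inverse_def)
  moreover have "res B w o\<^sub>L ((w *\<^sub>C id_op - B) o\<^sub>L res B z) = res B z"
    using w by (simp add: op_inverse_def flip: blinfun_compose_assoc)
  ultimately have "res B w - res B z =
      res B w o\<^sub>L (((z *\<^sub>C id_op - B) - (w *\<^sub>C id_op - B)) o\<^sub>L res B z)"
    by (metis (no_types) blinfun_compose_distrib(3,4))
  also have "(z *\<^sub>C id_op - B) - (w *\<^sub>C id_op - B) = (z - w) *\<^sub>C id_op"
    by (simp add: scaleC.diff_left)
  finally show ?thesis by (simp add: blinfun_compose_scaleC_right[OF w(2)])
qed

lemma continuous_res:
  assumes "clin B" shows "continuous_on (clin.resolvent_set B) (res B)"
proof (rule continuous_at_imp_continuous_on, rule ballI)
  fix z assume z: "z \<in> clin.resolvent_set B"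
  \<comment> \<open>If \<open>|w - z|\<close> times the norm of \<open>res B z\<close> is at most
    1/2, the resolvent identity bounds the norm of \<open>res B w\<close> by twice that of
    \<open>res B z\<close>. The constant is this bound, with 1 added against division by zero, times
    the norm of \<open>res B z\<close>.\<close>
  let ?K = "2 * (norm (res B z) + 1) * norm (res B z)"
  have "norm (res B w - res B z) \<le> cmod (w - z) * ?K"
    if w: "w \<in> clin.resolvent_set B" "dist w z < 1 / (2 * (norm (res B z) + 1))" for w
  proof -
    have le: "norm (res B w - res B z) \<le> cmod (w - z) * (norm (res B w) * norm (res B z))"
      unfolding res_identity[OF z w(1)] norm_scaleC
      by (metis mult_left_mono norm_blinfun_compose norm_ge_zero norm_minus_commute)
    have half: "cmod (w - z) * norm (res B z) \<le> 1 / 2"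
    proof -
      have "cmod (w - z) * norm (res B z) \<le> cmod (w - z) * (norm (res B z) + 1)"
        by (intro mult_left_mono) auto
      also have "\<dots> \<le> 1 / (2 * (norm (res B z) + 1)) * (norm (res B z) + 1)"
        using w(2) by (intro mult_right_mono) (auto simp: dist_norm)
      also have "\<dots> = 1 / 2"
        using add_nonneg_pos[OF norm_ge_zero zero_less_one, of "res B z"] by (simp add: divide_simps)
      finally show ?thesis .
    qed
    have "norm (res B w) \<le> norm (res B z) + norm (res B w - res B z)"
      by (metis add.commute diff_add_cancel norm_triangle_ineq)
    also have "norm (res B w - res B z) \<le> 1 / 2 * norm (res B w)"
      using le mult_right_mono[OF half norm_ge_zero[of "res B w"]] by (simp add: mult_ac)
    finally have "norm (res B w) \<le> 2 * (norm (res B z) + 1)" by simp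
    then have "norm (res B w) * norm (res B z) \<le> ?K" by (rule mult_right_mono) simp
    with le show ?thesis by (meson mult_left_mono norm_ge_zero order_trans)
  qed
  moreover have "\<forall>\<^sub>F w in at z. w \<in> clin.resolvent_set B \<and> dist w z < 1 / (2 * (norm (res B z) + 1))"
    using clin.open_resolvent_set[OF assms] z
    by (intro eventually_conj eventually_at_in_open' eventually_at_le)
      (auto simp: eventually_at add_nonneg_pos intro!: exI[of _ "1 / (2 * (norm (res B z) + 1))"])
  ultimately have "\<forall>\<^sub>F w in at z. norm (res B w - res B z) \<le> cmod (w - z) * ?K"
    by (auto elim: eventually_mono)
  moreover have "((\<lambda>w. cmod (w - z) * ?K) \<longlongrightarrow> 0) (at z)"
    by (auto intro!: tendsto_eq_intros)
  ultimately have "((\<lambda>w. res B w - res B z) \<longlongrightarrow> 0) (at z)"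
    by (rule Lim_null_comparison)
  then show "isCont (res B) z" by (simp add: isCont_def LIM_zero_iff)
qed

text \<open>By the resolvent identity the remainder of the linear approximation is exactly
  \<open>-h (R(z + h) - R(z)) R(z)\<close>, where \<open>R\<close> abbreviates \<open>res B\<close>.
  Continuity of \<open>R\<close> therefore gives both the derivative \<open>-R(z) R(z)\<close> and
  its continuity.\<close>

lemma C1_holomorphic_res:
  assumes "clin B" shows "C1_holomorphic (res B) (clin.resolvent_set B)"
proof -
  let ?R = "clin.resolvent_set B"
  note cont = continuous_res[OF assms]
  have "(res B has_derivative (\<lambda>h. h *\<^sub>C (- (res B z o\<^sub>L res B z)))) (at z)" if z: "z \<in> ?R" for z
    unfolding has_derivative_at
  proof
    show "bounded_linear (\<lambda>h. h *\<^sub>C (- (res B z o\<^sub>L res B z)))"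
      by (rule scaleC.bounded_linear_left)
    have "norm (res B (z + h) - res B z - h *\<^sub>C (- (res B z o\<^sub>L res B z))) / norm h
        \<le> norm (res B (z + h) - res B z) * norm (res B z)" if "z + h \<in> ?R" "h \<noteq> 0" for h
    proof -
      have "res B (z + h) - res B z = (- h) *\<^sub>C (res B (z + h) o\<^sub>L res B z)"
        using res_identity[OF z that(1)] by simp
      then have "res B (z + h) - res B z - h *\<^sub>C (- (res B z o\<^sub>L res B z))
          = (- h) *\<^sub>C (res B (z + h) o\<^sub>L res B z) - h *\<^sub>C (- (res B z o\<^sub>L res B z))"
        by (rule arg_cong)
      also have "\<dots> = (- h) *\<^sub>C ((res B (z + h) - res B z) o\<^sub>L res B z)"
        by (simp add: blinfun_compose_distrib scaleC.diff_right scaleC.minus_left scaleC.minus_right)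
      finally show ?thesis
        using norm_blinfun_compose[of "res B (z + h) - res B z" "res B z"] that(2)
        by (simp add: norm_scaleC)
    qed
    moreover have "\<forall>\<^sub>F h in at 0. z + h \<in> ?R \<and> h \<noteq> 0"
    proof -
      have "\<forall>\<^sub>F w in nhds z. w \<in> ?R"
        using clin.open_resolvent_set[OF assms] z by (rule eventually_nhds_in_open)
      then have "\<forall>\<^sub>F w in at z. w \<in> ?R" by (rule eventually_at_filter[THEN iffD2, OF eventually_mono]) simp
      then have "\<forall>\<^sub>F h in at 0. h + z \<in> ?R" by (simp add: at_to_0[of z] eventually_filtermap)
      then show ?thesis
        by (intro eventually_conj eventually_neq_at_within) (simp add: add.commute)
    qed
    ultimately have ev: "\<forall>\<^sub>F h in at 0. norm (norm (res B (z + h) - res B z - h *\<^sub>C (- (res B z o\<^sub>L res B z))) / norm h)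
        \<le> norm (res B (z + h) - res B z) * norm (res B z)"
      by (auto elim!: eventually_mono)
    have "isCont (res B) z"
      using cont z clin.open_resolvent_set[OF assms] by (simp add: continuous_on_eq_continuous_at)
    then have "((\<lambda>h. res B (z + h)) \<longlongrightarrow> res B z) (at 0)" by (simp add: isCont_iff)
    then have "((\<lambda>h. norm (res B (z + h) - res B z) * norm (res B z)) \<longlongrightarrow> 0) (at 0)"
      by (auto intro!: tendsto_eq_intros)
    with ev show "(\<lambda>h. norm (res B (z + h) - res B z - h *\<^sub>C (- (res B z o\<^sub>L res B z))) / norm h) \<midarrow>0\<rightarrow> 0"
      by (rule Lim_null_comparison)
  qed
  moreover have "continuous_on ?R (\<lambda>z. - (res B z o\<^sub>L res B z))"
    by (intro continuous_intros bounded_bilinear.continuous_on[OF bounded_bilinear_blinfun_compose] cont)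
  ultimately show ?thesis unfolding C1_holomorphic_def by blast
qed

section \<open>Independence of the contour\<close>

text \<open>On such a set the scalar Cauchy formula holds for every closed curve separately.\<close>

definition convex_components :: "complex set \<Rightarrow> bool" where
  "convex_components D \<longleftrightarrow> open D \<and>
     (\<forall>S. connected S \<and> S \<noteq> {} \<and> S \<subseteq> D \<longrightarrow> (\<exists>C. open C \<and> convex C \<and> S \<subseteq> C \<and> C \<subseteq> D))"

definition closed_curve_in :: "complex set \<Rightarrow> (real \<Rightarrow> complex) \<Rightarrow> bool" where
  "closed_curve_in U \<gamma> \<longleftrightarrow> valid_path \<gamma> \<and> pathfinish \<gamma> = pathstart \<gamma> \<and> path_image \<gamma> \<subseteq> U"

text \<open>The image of the curve is connected, hence inside one convex \<open>C\<close>. For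
  \<open>z\<close> outside \<open>C\<close> the integrand is holomorphic on \<open>C\<close> and the
  winding number is 0. This includes \<open>z\<close> outside \<open>D\<close>, where
  \<open>f z\<close> has no meaning but is multiplied by 0.\<close>

lemma has_contour_integral_cauchy:
  assumes "convex_components D" "f holomorphic_on D" "closed_curve_in (D - {z}) \<gamma>"
  shows "((\<lambda>w. f w / (w - z)) has_contour_integral (2 * pi * \<i> * winding_number \<gamma> z * f z)) \<gamma>"
proof -
  have \<gamma>: "valid_path \<gamma>" "pathfinish \<gamma> = pathstart \<gamma>" "path_image \<gamma> \<subseteq> D - {z}"
    using assms(3) by (auto simp: closed_curve_in_def)
  have p: "path \<gamma>" using \<gamma>(1) by (rule valid_path_imp_path)
  have "path_image \<gamma> \<subseteq> D" using \<gamma>(3) by blast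
  with connected_path_image[OF p] path_image_nonempty[of \<gamma>] assms(1)
  obtain C where C: "open C" "convex C" "path_image \<gamma> \<subseteq> C" "C \<subseteq> D"
    unfolding convex_components_def by meson
  have fC: "f holomorphic_on C" using assms(2) C(4) by (rule holomorphic_on_subset)
  show ?thesis
  proof (cases "z \<in> C")
    case True
    then show ?thesis
      using Cauchy_integral_formula_convex_simple[OF C(2) fC _ \<gamma>(1) _ \<gamma>(2)] C \<gamma>(3)
      by (auto simp: interior_open)
  next
    case False
    then have "(\<lambda>w. f w / (w - z)) holomorphic_on C"
      using fC by (auto intro!: holomorphic_intros)
    then have "((\<lambda>w. f w / (w - z)) has_contour_integral 0) \<gamma>"
      using C \<gamma> by (intro Cauchy_theorem_convex_simple)
    moreover have "winding_number \<gamma> z = 0"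
      using winding_number_zero_outside[OF p C(2) \<gamma>(2) False C(3)] .
    ultimately show ?thesis by simp
  qed
qed

text \<open>\<open>H z\<close> is the integral of \<open>f(w) res B w / (w - z)\<close> over
  \<open>\<gamma>\<close>. Since \<open>(z - B) res B w = 1 - (w - z) res B w\<close>,
  multiplication by \<open>z - B\<close> leaves a scalar Cauchy integral minus an integral free of
  \<open>z\<close>. The set \<open>K\<close> lies in the resolvent set, so \<open>H\<close> is
  holomorphic in a neighbourhood of the spectrum.\<close>

lemma cauchy_transform_resolvent:
  fixes B :: "'a::complex_banach \<Rightarrow>\<^sub>L 'a"
  assumes B: "clin B" and D: "convex_components D" "f holomorphic_on D"
    and \<gamma>: "closed_curve_in (D \<inter> clin.resolvent_set B) \<gamma>"
  shows "\<exists>H K. compact K \<and> path_image \<gamma> \<subseteq> K \<and> K \<subseteq> clin.resolvent_set B \<and>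
    C1_holomorphic H (- K) \<and> (H \<longlongrightarrow> 0) at_infinity \<and>
    (\<forall>z. z \<notin> K \<longrightarrow> (z *\<^sub>C id_op - B) o\<^sub>L H z =
       (2 * pi * \<i> * winding_number \<gamma> z * f z) *\<^sub>C id_op - path_integral \<gamma> (\<lambda>w. f w *\<^sub>C res B w))"
proof -
  define U where "U = D \<inter> clin.resolvent_set B"
  have U: "open U"
    using D(1) clin.open_resolvent_set[OF B] by (auto simp: U_def convex_components_def)
  have v: "valid_path \<gamma>" and im: "path_image \<gamma> \<subseteq> U"
    using \<gamma> by (auto simp: closed_curve_in_def U_def)
  note p = valid_path_imp_path[OF v]
  obtain e m where em: "fine_partition \<gamma> e m" "(\<Union>k<m. cball (vertex \<gamma> m k) e) \<subseteq> U"
    using fine_partition_exists[OF p im U] .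
  let ?v = "vertex \<gamma> m"
  define K where "K = path_image \<gamma> \<union> (\<Union>k<m. cball (?v k) e)"
  define F where "F w = f w *\<^sub>C res B w" for w
  \<comment> \<open>Defined by chords rather than by the path, because integrals over segments can
    be differentiated in \<open>z\<close>; off \<open>K\<close> both descriptions agree.\<close>
  define H where "H z = (\<Sum>k<m. segment_integral (\<lambda>w. (1 / (w - z)) *\<^sub>C F w) (?v k) (?v (Suc k)))" for z
  have balls: "(\<Union>k<m. ball (?v k) e) \<subseteq> K" by (auto simp: K_def)
  have seg: "closed_segment (?v k) (?v (Suc k)) \<subseteq> K" if "k < m" for k
    using segment_subset_ball[OF em(1) that] balls that by blast
  have K: "compact K" "path_image \<gamma> \<subseteq> K" "K \<subseteq> U"
    using em(2) im by (auto simp: K_def compact_path_image[OF p] intro!: compact_UN)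
  have fU: "f holomorphic_on U" using D(2) by (rule holomorphic_on_subset) (auto simp: U_def)
  have FU: "C1_holomorphic F U"
    unfolding F_def
    by (intro C1_holomorphic_scaleC fU U C1_holomorphic_subset[OF C1_holomorphic_res[OF B]])
      (auto simp: U_def)
  have segF: "continuous_on (closed_segment (?v k) (?v (Suc k))) F" if "k < m" for k
    using C1_holomorphic_continuous_on[OF FU] by (rule continuous_on_subset) (use seg[OF that] K in blast)
  have H1: "C1_holomorphic H (- K)"
    unfolding H_def
    by (intro C1_holomorphic_sum C1_holomorphic_subset[OF C1_holomorphic_cauchy_transform[OF segF]])
      (use seg in auto)
  have H0: "(H \<longlongrightarrow> 0) at_infinity"
    unfolding H_def by (rule tendsto_null_sum) (simp add: cauchy_transform_tendsto_0[OF segF])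
  have "(z *\<^sub>C id_op - B) o\<^sub>L H z =
      (2 * pi * \<i> * winding_number \<gamma> z * f z) *\<^sub>C id_op - path_integral \<gamma> F" if z: "z \<notin> K" for z
  proof -
    let ?U = "U - {z}" and ?G = "\<lambda>w. (1 / (w - z)) *\<^sub>C F w" and ?g = "\<lambda>w. f w / (w - z)"
    let ?Z = "z *\<^sub>C id_op - B"
    have U': "open ?U" "path_image \<gamma> \<subseteq> ?U" "(\<Union>k<m. ball (?v k) e) \<subseteq> ?U"
      using U K z balls by auto
    have G: "C1_holomorphic ?G ?U"
      by (intro C1_holomorphic_scaleC U' holomorphic_intros C1_holomorphic_subset[OF FU]) auto
    have g: "C1_holomorphic ?g ?U"
      by (intro C1_holomorphic_complex U' holomorphic_intros holomorphic_on_subset[OF fU]) auto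
    note int = path_integrand_integrable[OF v U'(2,1)]
    have Z: "clin ?Z" using B by (intro clin_intros)
    have "H z = path_integral \<gamma> ?G"
      unfolding H_def using path_integral_polygon[OF v em(1) C1_holomorphic_subset[OF G U'(3)]] ..
    then have "?Z o\<^sub>L H z = path_integral \<gamma> (\<lambda>w. ?Z o\<^sub>L ?G w)"
      by (simp only: path_integral_linear[OF int[OF G] bounded_linear_compose_right
            blinfun_compose_scaleC_right[OF Z]])
    also have "\<dots> = integral {0..1} (\<lambda>s. path_integrand \<gamma> (\<lambda>w. ?g w *\<^sub>C id_op) s - path_integrand \<gamma> F s)"
      unfolding path_integral_def
    proof (rule integral_cong)
      fix s :: real assume "s \<in> {0..1}"
      then have w: "\<gamma> s \<in> ?U" using U'(2) unfolding path_image_def by blast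
      let ?w = "\<gamma> s"
      have inv: "op_inverse (res B ?w) (?w *\<^sub>C id_op - B)"
        using w res_inverse by (auto simp: U_def)
      have "?Z = (?w *\<^sub>C id_op - B) - (?w - z) *\<^sub>C id_op" by (simp add: scaleC.diff_left)
      then have "?Z o\<^sub>L res B ?w = ((?w *\<^sub>C id_op - B) - (?w - z) *\<^sub>C id_op) o\<^sub>L res B ?w"
        by (rule arg_cong)
      also have "\<dots> = ((?w *\<^sub>C id_op - B) o\<^sub>L res B ?w) - (((?w - z) *\<^sub>C id_op) o\<^sub>L res B ?w)"
        by (rule blinfun_compose_distrib(3))
      finally have "?Z o\<^sub>L res B ?w = id_op - (?w - z) *\<^sub>C res B ?w"
        using inv by (simp add: op_inverse_def)
      moreover have "?w - z \<noteq> 0" using w by auto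
      ultimately have "?Z o\<^sub>L ?G ?w = ?g ?w *\<^sub>C id_op - F ?w"
        by (simp add: F_def blinfun_compose_scaleC_right[OF Z] scaleC_scaleC scaleC.diff_right)
      then show "path_integrand \<gamma> (\<lambda>w. ?Z o\<^sub>L ?G w) s
          = path_integrand \<gamma> (\<lambda>w. ?g w *\<^sub>C id_op) s - path_integrand \<gamma> F s"
        by (simp add: path_integrand_def scaleC.diff_right)
    qed
    also have "\<dots> = path_integral \<gamma> (\<lambda>w. ?g w *\<^sub>C id_op) - path_integral \<gamma> F"
      unfolding path_integral_def
    proof (rule integral_diff)
      show "path_integrand \<gamma> (\<lambda>w. ?g w *\<^sub>C id_op) integrable_on {0..1}"
        by (rule int, rule C1_holomorphic_bounded_linear[OF g scaleC.bounded_linear_left])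
          (simp add: scaleC_scaleC scaleC_complex_eq)
      show "path_integrand \<gamma> F integrable_on {0..1}"
        by (rule int, rule C1_holomorphic_subset[OF FU]) auto
    qed
    also have "path_integral \<gamma> (\<lambda>w. ?g w *\<^sub>C id_op) = path_integral \<gamma> ?g *\<^sub>C (id_op :: 'a \<Rightarrow>\<^sub>L 'a)"
      by (rule path_integral_linear[OF int[OF g] scaleC.bounded_linear_left])
        (simp add: scaleC_scaleC scaleC_complex_eq)
    also have "path_integral \<gamma> ?g = 2 * pi * \<i> * winding_number \<gamma> z * f z"
      by (rule path_integral_complex, rule has_contour_integral_cauchy[OF D])
        (use \<gamma> U'(2) in \<open>auto simp: closed_curve_in_def\<close>)
    finally show ?thesis .
  qed
  with K H1 H0 show ?thesis
    unfolding F_def U_def by blast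
qed

text \<open>Write \<open>T\<close> for the difference of the two integrals. The Cauchy transforms of the contours
  show that \<open>-(z - B)\<^sup>-\<^sup>1 T\<close> extends holomorphically across the spectrum of \<open>B\<close>, where the
  winding numbers agree, and vanishes at infinity; so it is zero by Liouville's theorem.\<close>

theorem cauchy_integral_resolvent_independent:
  fixes B :: "'a::complex_banach \<Rightarrow>\<^sub>L 'a"
  assumes B: "clin B" and D: "convex_components D" "f holomorphic_on D"
    and \<Gamma>: "\<And>\<gamma>. \<gamma> \<in> set \<Gamma> \<Longrightarrow> closed_curve_in (D \<inter> clin.resolvent_set B) \<gamma>"
    and \<Gamma>': "\<And>\<gamma>. \<gamma> \<in> set \<Gamma>' \<Longrightarrow> closed_curve_in (D \<inter> clin.resolvent_set B) \<gamma>"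
    and wind: "\<And>z. z \<notin> clin.resolvent_set B \<Longrightarrow>
      (\<Sum>\<gamma>\<leftarrow>\<Gamma>. winding_number \<gamma> z) = (\<Sum>\<gamma>\<leftarrow>\<Gamma>'. winding_number \<gamma> z)"
  shows "cauchy_integral \<Gamma> (\<lambda>z. f z *\<^sub>C res B z) = cauchy_integral \<Gamma>' (\<lambda>z. f z *\<^sub>C res B z)"
proof -
  let ?S = "set \<Gamma> \<union> set \<Gamma>'" and ?R = "clin.resolvent_set B"
  let ?I = "\<lambda>\<gamma>. path_integral \<gamma> (\<lambda>w. f w *\<^sub>C res B w)"
  have S: "closed_curve_in (D \<inter> ?R) \<gamma>" if "\<gamma> \<in> ?S" for \<gamma> using \<Gamma> \<Gamma>' that by auto
  then have S': "path \<gamma>" "pathfinish \<gamma> = pathstart \<gamma>" if "\<gamma> \<in> ?S" for \<gamma>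
    using that by (auto simp: closed_curve_in_def valid_path_imp_path)
  define P where "P \<gamma> H K \<longleftrightarrow> compact K \<and> path_image \<gamma> \<subseteq> K \<and> K \<subseteq> ?R \<and>
    C1_holomorphic H (- K) \<and> (H \<longlongrightarrow> 0) at_infinity \<and>
    (\<forall>z. z \<notin> K \<longrightarrow> (z *\<^sub>C id_op - B) o\<^sub>L H z =
       (2 * pi * \<i> * winding_number \<gamma> z * f z) *\<^sub>C id_op - ?I \<gamma>)" for \<gamma> H K
  have "\<exists>H K. P \<gamma> H K" if "\<gamma> \<in> ?S" for \<gamma>
    unfolding P_def by (rule cauchy_transform_resolvent[OF B D S[OF that]])
  then obtain h k where "\<And>\<gamma>. \<gamma> \<in> ?S \<Longrightarrow> P \<gamma> (h \<gamma>) (k \<gamma>)" by metis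
  note hk = this[unfolded P_def]
  define K where "K = (\<Union>\<gamma>\<in>?S. k \<gamma>)"
  define H where "H z = (\<Sum>\<gamma>\<leftarrow>\<Gamma>. h \<gamma> z) - (\<Sum>\<gamma>\<leftarrow>\<Gamma>'. h \<gamma> z)" for z
  define T where "T = (\<Sum>\<gamma>\<leftarrow>\<Gamma>. ?I \<gamma>) - (\<Sum>\<gamma>\<leftarrow>\<Gamma>'. ?I \<gamma>)"
  \<comment> \<open>Together with the resolvent set, this open set covers the plane, and it is a
    neighbourhood of infinity because all winding numbers vanish far out.\<close>
  define V where "V = {z. z \<notin> K \<and> (\<Sum>\<gamma>\<leftarrow>\<Gamma>. winding_number \<gamma> z) = (\<Sum>\<gamma>\<leftarrow>\<Gamma>'. winding_number \<gamma> z)}"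
  have K: "compact K" "K \<subseteq> ?R" "\<And>\<gamma>. \<gamma> \<in> ?S \<Longrightarrow> path_image \<gamma> \<subseteq> K"
  proof -
    have k: "compact (k \<gamma>)" "path_image \<gamma> \<subseteq> k \<gamma>" "k \<gamma> \<subseteq> ?R" if "\<gamma> \<in> ?S" for \<gamma>
      using hk[OF that] by auto
    show "compact K" unfolding K_def by (intro compact_UN k) auto
    show "K \<subseteq> ?R" "\<And>\<gamma>. \<gamma> \<in> ?S \<Longrightarrow> path_image \<gamma> \<subseteq> K" unfolding K_def using k(2,3) by blast+
  qed
  have eq_list: "(z *\<^sub>C id_op - B) o\<^sub>L (\<Sum>\<gamma>\<leftarrow>\<Lambda>. h \<gamma> z) =
      (2 * pi * \<i> * (\<Sum>\<gamma>\<leftarrow>\<Lambda>. winding_number \<gamma> z) * f z) *\<^sub>C id_op - (\<Sum>\<gamma>\<leftarrow>\<Lambda>. ?I \<gamma>)"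
    if "set \<Lambda> \<subseteq> ?S" "z \<notin> K" for \<Lambda> z
    using that(1)
  proof (induction \<Lambda>)
    case (Cons \<gamma> \<Lambda>)
    have "z \<notin> k \<gamma>" using Cons.prems that(2) by (auto simp: K_def)
    then have 1: "(z *\<^sub>C id_op - B) o\<^sub>L h \<gamma> z = (2 * pi * \<i> * winding_number \<gamma> z * f z) *\<^sub>C id_op - ?I \<gamma>"
      using hk[of \<gamma>] Cons.prems by auto
    have 2: "(z *\<^sub>C id_op - B) o\<^sub>L (\<Sum>\<gamma>\<leftarrow>\<Lambda>. h \<gamma> z) =
      (2 * pi * \<i> * (\<Sum>\<gamma>\<leftarrow>\<Lambda>. winding_number \<gamma> z) * f z) *\<^sub>C id_op - (\<Sum>\<gamma>\<leftarrow>\<Lambda>. ?I \<gamma>)"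
      using Cons by simp
    have 3: "(2 * pi * \<i> * (a + b) * f z) *\<^sub>C (id_op :: 'a \<Rightarrow>\<^sub>L 'a)
        = (2 * pi * \<i> * a * f z) *\<^sub>C id_op + (2 * pi * \<i> * b * f z) *\<^sub>C id_op" for a b
      by (simp only: distrib_left distrib_right scaleC_add_left)
    show ?case
      unfolding list.map sum_list.Cons blinfun_compose_distrib(2) 1 2 3 by simp
  qed simp
  \<comment> \<open>On \<open>V\<close> the terms with \<open>f z\<close> cancel. They must, since
    \<open>V\<close> reaches outside \<open>D\<close>, where \<open>f z\<close> is
    arbitrary.\<close>
  have HT: "(z *\<^sub>C id_op - B) o\<^sub>L H z = - T" if "z \<in> V" for z
    using that eq_list[of \<Gamma> z] eq_list[of \<Gamma>' z]
    by (simp add: V_def H_def T_def blinfun_compose_distrib(4)[of _ "\<Sum>\<gamma>\<leftarrow>\<Gamma>. h \<gamma> z"])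
  have "open V"
  proof (rule openI)
    fix z assume z: "z \<in> V"
    define W where "W = - K \<inter> (\<Inter>\<gamma>\<in>?S. {x. x \<notin> path_image \<gamma> \<and> winding_number \<gamma> x = winding_number \<gamma> z})"
    have "open W"
      unfolding W_def using compact_imp_closed[OF K(1)]
      by (intro open_Int open_INT ballI open_winding_number_levelsets S') auto
    moreover have "z \<in> W" using z K(3) by (auto simp: W_def V_def)
    moreover have "W \<subseteq> V"
    proof
      fix x assume x: "x \<in> W"
      then have "(\<Sum>\<gamma>\<leftarrow>\<Lambda>. winding_number \<gamma> x) = (\<Sum>\<gamma>\<leftarrow>\<Lambda>. winding_number \<gamma> z)" if "set \<Lambda> \<subseteq> ?S" for \<Lambda>
        using that by (intro arg_cong[where f = sum_list] map_cong) (auto simp: W_def)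
      from this[of \<Gamma>] this[of \<Gamma>'] x z show "x \<in> V" by (simp add: V_def W_def)
    qed
    ultimately show "\<exists>e>0. ball z e \<subseteq> V" by (meson open_contains_ball order_trans)
  qed
  have UV: "?R \<union> V = UNIV"
    using wind K(2) by (auto simp: V_def)
  have evV: "\<forall>\<^sub>F z in at_infinity. z \<in> V"
  proof -
    have "\<forall>\<^sub>F z in at_infinity. winding_number \<gamma> z = 0" if "\<gamma> \<in> ?S" for \<gamma>
      using winding_number_zero_at_infinity[OF S'[OF that]] by (simp add: eventually_at_infinity)
    then have "\<forall>\<^sub>F z in at_infinity. \<forall>\<gamma>\<in>?S. winding_number \<gamma> z = 0"
      by (intro eventually_ball_finite) auto
    moreover have "\<forall>\<^sub>F z in at_infinity. z \<notin> K"
      using compact_imp_bounded[OF K(1)] unfolding bounded_iff eventually_at_infinity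
      by (metis add.commute add_le_same_cancel1 dual_order.trans not_one_le_zero)
    ultimately show ?thesis
    proof eventually_elim
      case (elim z)
      then have "(\<Sum>\<gamma>\<leftarrow>\<Lambda>. winding_number \<gamma> z) = 0" if "set \<Lambda> \<subseteq> ?S" for \<Lambda>
        using that by (induction \<Lambda>) auto
      from this[of \<Gamma>] this[of \<Gamma>'] show "z \<in> V" using elim by (simp add: V_def)
    qed
  qed
  \<comment> \<open>Multiplying \<open>HT\<close> by the resolvent shows that the two branches
    coincide on \<open>V\<close>. Hence the resolvent branch continues across the spectrum by means
    of \<open>H\<close>.\<close>
  define \<Phi> where "\<Phi> z = (if z \<in> ?R then - (res B z o\<^sub>L T) else H z)" for z
  have \<Phi>_V: "H z = \<Phi> z" if "z \<in> V" for z
  proof (cases "z \<in> ?R")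
    case True
    then have "H z = res B z o\<^sub>L ((z *\<^sub>C id_op - B) o\<^sub>L H z)"
      using res_inverse(1)[OF True] by (simp add: op_inverse_def flip: blinfun_compose_assoc)
    also have "\<dots> = - (res B z o\<^sub>L T)"
      unfolding HT[OF that] by (rule blinfun_compose_distrib(6))
    finally show ?thesis using True by (simp add: \<Phi>_def)
  qed (simp add: \<Phi>_def)
  have "C1_holomorphic (\<lambda>z. - (res B z o\<^sub>L T)) ?R"
    by (rule C1_holomorphic_bounded_linear[OF C1_holomorphic_res[OF B]])
      (auto intro!: bounded_linear_minus bounded_linear_compose_left simp: scaleC.minus_right)
  then have "C1_holomorphic \<Phi> ?R"
    by (rule C1_holomorphic_cong_open[OF _ clin.open_resolvent_set[OF B]]) (simp add: \<Phi>_def)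
  moreover have "C1_holomorphic (h \<gamma>) V" if "\<gamma> \<in> ?S" for \<gamma>
    using hk[OF that] that by (elim C1_holomorphic_subset conjE) (auto simp: V_def K_def)
  then have "C1_holomorphic H V"
    unfolding H_def by (intro C1_holomorphic_diff C1_holomorphic_sum_list) auto
  then have "C1_holomorphic \<Phi> V"
    by (rule C1_holomorphic_cong_open[OF _ \<open>open V\<close> \<Phi>_V])
  ultimately have "C1_holomorphic \<Phi> UNIV"
    using C1_holomorphic_Un[OF _ _ clin.open_resolvent_set[OF B] \<open>open V\<close>] UV by metis
  moreover have "(\<Phi> \<longlongrightarrow> 0) at_infinity"
  proof (rule Lim_transform_eventually)
    have "((\<lambda>z. \<Sum>\<gamma>\<leftarrow>\<Lambda>. h \<gamma> z) \<longlongrightarrow> 0) at_infinity" if "set \<Lambda> \<subseteq> ?S" for \<Lambda>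
      using that
    proof (induction \<Lambda>)
      case (Cons \<gamma> \<Lambda>)
      then show ?case using tendsto_add[of "h \<gamma>" 0 at_infinity _ 0] hk[of \<gamma>] by simp
    qed simp
    from tendsto_diff[OF this this]
    show "(H \<longlongrightarrow> 0) at_infinity" unfolding H_def by simp
    show "\<forall>\<^sub>F z in at_infinity. H z = \<Phi> z" using evV \<Phi>_V by (rule eventually_mono)
  qed
  ultimately have \<Phi>0: "\<Phi> z = 0" for z by (rule C1_holomorphic_Liouville_0)
  \<comment> \<open>One point of \<open>V\<close> suffices: there \<open>(z - B) H z = -T\<close>
    and \<open>H z = 0\<close>.\<close>
  obtain z where "z \<in> V" using eventually_happens[OF evV] trivial_limit_at_infinity by blast
  then have "T = 0" using HT[of z] \<Phi>_V[of z] \<Phi>0[of z] by simp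
  then show ?thesis by (simp add: cauchy_integral_eq T_def)
qed

section \<open>Direct sums and operator matrices\<close>

declare One_nat_def [simp del]

locale direct_sum =
  fixes n :: nat and X :: "nat \<Rightarrow> 'a::complex_banach set"
  assumes decomp: "direct_decomp n X"
begin

abbreviation "I \<equiv> {1..n}"
abbreviation "cmp \<equiv> component n X"

lemma subspace: "i \<in> I \<Longrightarrow> complex_vector.subspace (X i)"
  and closed_summand: "i \<in> I \<Longrightarrow> closed (X i)"
  using decomp by (auto simp: direct_decomp_def)

lemma
  shows component_mem: "i \<in> I \<Longrightarrow> cmp i x \<in> X i"
    and component_sum: "(\<Sum>i\<in>I. cmp i x) = x"
proof -
  let ?P = "\<lambda>u. u \<in> (\<Pi>\<^sub>E i\<in>I. X i) \<and> x = (\<Sum>i\<in>I. u i)"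
  have "\<exists>!u. ?P u" using decomp by (auto simp: direct_decomp_def)
  from theI'[OF this] have "?P (THE u. ?P u)" .
  then show "i \<in> I \<Longrightarrow> cmp i x \<in> X i" "(\<Sum>i\<in>I. cmp i x) = x"
    unfolding component_def by auto
qed

lemma component_unique:
  assumes "\<And>i. i \<in> I \<Longrightarrow> u i \<in> X i" "i \<in> I"
  shows "cmp i (\<Sum>i\<in>I. u i) = u i"
proof -
  let ?x = "\<Sum>i\<in>I. u i"
  let ?P = "\<lambda>u. u \<in> (\<Pi>\<^sub>E i\<in>I. X i) \<and> ?x = (\<Sum>i\<in>I. u i)"
  have ex: "\<exists>!u. ?P u" using decomp by (auto simp: direct_decomp_def)
  \<comment> \<open>The product set consists of functions with a fixed default value off the index
    set, hence the restrictions.\<close>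
  have "?P (restrict u I)" using assms by (auto intro!: sum.cong)
  moreover have "?P (restrict (\<lambda>i. cmp i ?x) I)"
    using component_mem component_sum[of ?x] by auto
  ultimately have "restrict u I = restrict (\<lambda>i. cmp i ?x) I" using ex by blast
  then show ?thesis using assms(2) by (metis restrict_apply')
qed

lemma component_add: "i \<in> I \<Longrightarrow> cmp i (x + y) = cmp i x + cmp i y"
  using component_unique[of "\<lambda>i. cmp i x + cmp i y" i] component_mem subspace component_sum
  by (simp add: sum.distrib complex_vector.subspace_add)

lemma component_scaleC: "i \<in> I \<Longrightarrow> cmp i (c *\<^sub>C x) = c *\<^sub>C cmp i x"
  using component_unique[of "\<lambda>i. c *\<^sub>C cmp i x" i] component_mem subspace component_sum
  by (simp add: complex_vector.subspace_scale flip: scaleC.sum_right)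

lemma component_scaleR: "i \<in> I \<Longrightarrow> cmp i (r *\<^sub>R x) = r *\<^sub>R cmp i x"
  by (simp add: scaleR_scaleC component_scaleC)

lemma component_diff: "i \<in> I \<Longrightarrow> cmp i (x - y) = cmp i x - cmp i y"
  using component_add[of i x "- y"] component_scaleR[of i "- 1" y] by simp

lemma component_zero: "i \<in> I \<Longrightarrow> cmp i 0 = 0"
  using component_scaleR[of i 0 0] by simp

lemma component_in: "i \<in> I \<Longrightarrow> j \<in> I \<Longrightarrow> x \<in> X j \<Longrightarrow> cmp i x = (if i = j then x else 0)"
  using component_unique[of "\<lambda>i. if i = j then x else 0" i] complex_vector.subspace_0[OF subspace]
  by (simp split: if_splits)

text \<open>Baire's theorem makes the points with small components dense in a ball, and successive
  approximation then removes the closure, as in the open mapping theorem.\<close>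

lemma component_approx:
  obtains k r where "k \<ge> 0" "r > 0"
    "\<And>t y \<epsilon>. t > 0 \<Longrightarrow> norm y < r * t \<Longrightarrow> \<epsilon> > 0 \<Longrightarrow>
      \<exists>x. (\<forall>i\<in>I. norm (cmp i x) \<le> k * t) \<and> norm (y - x) < \<epsilon>"
proof -
  define E where "E k = {x. \<forall>i\<in>I. norm (cmp i x) \<le> real k}" for k :: nat
  have "(\<Union>k. closure (E k)) = UNIV"
  proof -
    have "x \<in> E (nat \<lceil>\<Sum>i\<in>I. norm (cmp i x)\<rceil>)" for x
    proof -
      have "norm (cmp i x) \<le> (\<Sum>i\<in>I. norm (cmp i x))" if "i \<in> I" for i
        using that by (intro member_le_sum) auto
      then show ?thesis unfolding E_def by (smt (verit) mem_Collect_eq real_nat_ceiling_ge)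
    qed
    then show ?thesis using closure_subset by blast
  qed
  then have "interior (\<Union>(range (\<lambda>k. closure (E k)))) \<noteq> {}" by simp
  moreover have "Met_TC.mcomplete TYPE('a)"
    by (simp add: complete_UNIV)
  from Met_TC.metric_Baire_category_alt[OF this, of "range (\<lambda>k. closure (E k))"]
  have "interior (\<Union>(range (\<lambda>k. closure (E k)))) = {}" if "\<And>k. interior (closure (E k)) = {}"
    using that by fastforce
  ultimately have "\<exists>k. interior (closure (E k)) \<noteq> {}" by blast
  then obtain k x0 where "x0 \<in> interior (closure (E k))" by blast
  then obtain r where r: "r > 0" "ball x0 r \<subseteq> closure (E k)"
    by (meson mem_interior)
  have unit: "\<exists>x\<in>E k. norm (y - x) < \<epsilon>" if y: "norm y < r" and \<epsilon>: "\<epsilon> > 0" for y \<epsilon>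
  proof -
    \<comment> \<open>\<open>E k\<close> is symmetric and convex. Half the difference of
      approximations to \<open>x0 + y\<close> and \<open>x0 - y\<close> approximates
      \<open>y\<close>, which moves the ball to the origin.\<close>
    have "x0 + y \<in> closure (E k)" "x0 - y \<in> closure (E k)"
      using r(2) y by (auto simp: dist_norm)
    then obtain a b where ab: "a \<in> E k" "norm (a - (x0 + y)) < \<epsilon>" "b \<in> E k" "norm (b - (x0 - y)) < \<epsilon>"
      using \<epsilon> unfolding closure_approachable dist_norm by meson
    have "norm (cmp i ((1/2) *\<^sub>R (a - b))) \<le> real k" if "i \<in> I" for i
      using ab(1,3) that norm_triangle_ineq4[of "cmp i a" "cmp i b"]
      by (force simp: E_def component_scaleR component_diff)
    then have "(1/2) *\<^sub>R (a - b) \<in> E k" by (simp add: E_def)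
    moreover have "norm (y - (1/2) *\<^sub>R (a - b)) < \<epsilon>"
    proof -
      have "y - (1/2) *\<^sub>R (a - b) = (1/2) *\<^sub>R ((b - (x0 - y)) - (a - (x0 + y)))"
        by (simp add: algebra_simps flip: scaleR_add_left)
      then have "norm (y - (1/2) *\<^sub>R (a - b)) \<le> (norm (b - (x0 - y)) + norm (a - (x0 + y))) / 2"
        using norm_triangle_ineq4[of "b - (x0 - y)" "a - (x0 + y)"] by simp
      also have "\<dots> < \<epsilon>" using ab(2,4) by simp
      finally show ?thesis .
    qed
    ultimately show ?thesis by blast
  qed
  have "\<exists>x. (\<forall>i\<in>I. norm (cmp i x) \<le> real k * t) \<and> norm (y - x) < \<epsilon>"
    if "t > 0" "norm y < r * t" "\<epsilon> > 0" for t y \<epsilon>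
  proof -
    have "norm ((1/t) *\<^sub>R y) < r" "\<epsilon> / t > 0" using that by (simp_all add: field_simps)
    then obtain x where x: "x \<in> E k" "norm ((1/t) *\<^sub>R y - x) < \<epsilon> / t" using unit by blast
    have "y - t *\<^sub>R x = t *\<^sub>R ((1/t) *\<^sub>R y - x)" using that(1) by (simp add: scaleR_diff_right)
    then have "norm (y - t *\<^sub>R x) = t * norm ((1/t) *\<^sub>R y - x)"
      using that(1) by (metis abs_of_pos norm_scaleR)
    then have "norm (y - t *\<^sub>R x) < \<epsilon>" using x(2) that(1) by (simp add: field_simps)
    moreover have "norm (cmp i (t *\<^sub>R x)) \<le> real k * t" if "i \<in> I" for i
      using x(1) that \<open>t > 0\<close> by (simp add: E_def component_scaleR mult.commute mult_right_mono)
    ultimately show ?thesis by blast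
  qed
  with r(1) show ?thesis by (intro that[of "real k" r]) auto
qed

lemma bounded_linear_component:
  assumes i: "i \<in> I" shows "bounded_linear (cmp i)"
proof -
  obtain k r where k: "k \<ge> 0" and r: "r > 0" and approx: "\<And>t y \<epsilon>. t > 0 \<Longrightarrow> norm y < r * t \<Longrightarrow> \<epsilon> > 0 \<Longrightarrow>
      \<exists>x. (\<forall>i\<in>I. norm (cmp i x) \<le> k * t) \<and> norm (y - x) < \<epsilon>"
    using component_approx by metis
  let ?t = "\<lambda>j. (1 / 2) ^ j :: real"
  have bound: "norm (cmp i y) \<le> 2 * k" if y: "norm y < r" for y
  proof -
    \<comment> \<open>The error allowed at stage \<open>j\<close> is exactly the bound under which
      stage \<open>j + 1\<close> applies, so the remainders \<open>z j\<close> shrink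
      geometrically.\<close>
    define g where "g j y = (SOME x. (\<forall>i\<in>I. norm (cmp i x) \<le> k * ?t j) \<and> norm (y - x) < r * ?t (Suc j))" for j y
    have g: "(\<forall>i\<in>I. norm (cmp i (g j y)) \<le> k * ?t j) \<and> norm (y - g j y) < r * ?t (Suc j)"
      if "norm y < r * ?t j" for j y
      unfolding g_def by (rule someI_ex, rule approx) (use that r in auto)
    define z where "z = rec_nat y (\<lambda>j w. w - g j w)"
    have z: "z 0 = y" "z (Suc j) = z j - g j (z j)" for j by (simp_all add: z_def)
    have zj: "norm (z j) < r * ?t j" for j
      by (induction j) (use y g in \<open>auto simp: z\<close>)
    define x where "x j = g j (z j)" for j
    have xb: "norm (cmp i (x j)) \<le> k * ?t j" if "i \<in> I" for i j
      using g[OF zj] that by (auto simp: x_def)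
    have sum_x: "(\<Sum>j<m. x j) = y - z m" for m
      by (induction m) (simp_all add: z x_def)
    have "z \<longlonglongrightarrow> 0"
    proof (rule Lim_null_comparison)
      show "\<forall>\<^sub>F j in sequentially. norm (z j) \<le> r * ?t j" using zj by (simp add: less_imp_le)
      show "(\<lambda>j. r * ?t j) \<longlonglongrightarrow> 0"
        using tendsto_mult_right_zero[OF LIMSEQ_realpow_zero[of "1/2"], of r] by simp
    qed
    then have sx: "x sums y"
      unfolding sums_def sum_x using tendsto_diff[OF tendsto_const, of z 0 sequentially y] by simp
    have geo: "summable (\<lambda>j. k * ?t j)" "(\<Sum>j. k * ?t j) = 2 * k"
      by (auto simp: suminf_mult suminf_geometric)
    have sc: "summable (\<lambda>j. cmp i (x j))" if "i \<in> I" for i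
      by (rule summable_comparison_test'[OF geo(1)]) (use xb[OF that] in auto)
    define v where "v i = (\<Sum>j. cmp i (x j))" for i
    \<comment> \<open>Closedness of the summands enters here. Once the limits \<open>v i\<close> are
      in \<open>X i\<close> and sum to \<open>y\<close>, uniqueness of the decomposition identifies
      them with the components of \<open>y\<close>.\<close>
    have "v i \<in> X i" if "i \<in> I" for i
    proof (rule closed_sequentially[OF closed_summand[OF that]])
      show "(\<lambda>m. \<Sum>j<m. cmp i (x j)) \<longlonglongrightarrow> v i"
        unfolding v_def by (rule summable_LIMSEQ[OF sc[OF that]])
      show "(\<Sum>j<m. cmp i (x j)) \<in> X i" for m
        by (intro complex_vector.subspace_sum subspace component_mem that)
    qed
    moreover have "(\<lambda>j. \<Sum>i\<in>I. cmp i (x j)) sums (\<Sum>i\<in>I. v i)"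
      unfolding v_def by (intro sums_sum summable_sums sc)
    then have "(\<Sum>i\<in>I. v i) = y"
      using sx sums_unique2 by (simp add: component_sum)
    ultimately have "cmp i y = v i" using component_unique[of v i] i by simp
    also have "norm (v i) \<le> (\<Sum>j. k * ?t j)"
      unfolding v_def using xb[OF i] by (intro norm_suminf_le geo)
    finally show ?thesis using geo by simp
  qed
  show ?thesis
  \<comment> \<open>Scaling \<open>x\<close> to norm \<open>r / 2\<close> puts it in the ball where
    the components are at most \<open>2 k\<close>; undoing the scaling gives
    \<open>4 k / r\<close>.\<close>
  proof (rule bounded_linear_intro[where K = "4 * k / r"])
    fix x
    show "norm (cmp i x) \<le> norm x * (4 * k / r)"
    proof (cases "x = 0")
      case False
      let ?s = "r / (2 * norm x)"
      have s: "?s > 0" using False r by simp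
      have "norm (cmp i (?s *\<^sub>R x)) \<le> 2 * k" using False r by (intro bound) simp
      then have "?s * norm (cmp i x) \<le> 2 * k" using i s r by (simp add: component_scaleR)
      then show ?thesis using False r by (simp add: field_simps)
    qed (simp add: component_zero[OF i])
  qed (use i in \<open>simp_all add: component_add component_scaleR\<close>)
qed

section \<open>Operator matrices as operators on the whole space\<close>

abbreviation "P \<equiv> id_block n X"

lemma P_apply: "i \<in> I \<Longrightarrow> blinfun_apply (P i) x = cmp i x"
  by (simp add: id_block_def bounded_linear_Blinfun_apply bounded_linear_component)

lemma clin_P: "i \<in> I \<Longrightarrow> clin (P i)"
  by (simp add: clin_def P_apply component_scaleC)

lemma P_compose: "i \<in> I \<Longrightarrow> j \<in> I \<Longrightarrow> P i o\<^sub>L P j = (if i = j then P i else 0)"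
  by (auto intro!: blinfun_eqI simp: P_apply component_in[OF _ _ component_mem])

lemma P_idem: "i \<in> I \<Longrightarrow> P i o\<^sub>L (P i o\<^sub>L T) = P i o\<^sub>L T"
  by (simp add: P_compose flip: blinfun_compose_assoc)

lemma P_sum: "(\<Sum>i\<in>I. P i) = id_op"
  by (rule blinfun_eqI) (simp add: blinfun.sum_left P_apply component_sum)

text \<open>Replaces conditions on vectors of the summands by one operator identity, suited to
  computing with products.\<close>

lemma blocks_iff:
  assumes "i \<in> I" "j \<in> I"
  shows "T \<in> blocks n X i j \<longleftrightarrow> clin T \<and> P i o\<^sub>L (T o\<^sub>L P j) = T"
proof
  assume T: "T \<in> blocks n X i j"
  have eq: "cmp i (blinfun_apply T (cmp j x)) = blinfun_apply T x" for x
  proof -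
    have "blinfun_apply T x = (\<Sum>k\<in>I. blinfun_apply T (cmp k x))"
      by (metis blinfun.sum_right component_sum)
    also have "\<dots> = (\<Sum>k\<in>I. if k = j then blinfun_apply T (cmp j x) else 0)"
      using T component_mem by (intro sum.cong) (auto simp: blocks_def)
    finally have "blinfun_apply T x = blinfun_apply T (cmp j x)" using assms by simp
    moreover have "blinfun_apply T (cmp j x) \<in> X i"
      using T component_mem[OF assms(2)] by (simp add: blocks_def)
    ultimately show ?thesis using component_in[OF assms(1,1)] by simp
  qed
  have "P i o\<^sub>L (T o\<^sub>L P j) = T"
    by (intro blinfun_eqI)
      (simp only: blinfun_apply_blinfun_compose P_apply[OF assms(1)] P_apply[OF assms(2)] eq)
  then show "clin T \<and> P i o\<^sub>L (T o\<^sub>L P j) = T"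
    using T by (simp add: blocks_def clin_iff_linear)
next
  assume T: "clin T \<and> P i o\<^sub>L (T o\<^sub>L P j) = T"
  then have eq: "blinfun_apply T x = cmp i (blinfun_apply T (cmp j x))" for x
  proof -
    have "blinfun_apply (P i o\<^sub>L (T o\<^sub>L P j)) x = cmp i (blinfun_apply T (cmp j x))"
      by (simp add: P_apply[OF assms(1)] P_apply[OF assms(2)])
    with T show ?thesis by simp
  qed
  have "blinfun_apply T x \<in> X i" for x
    by (subst eq) (rule component_mem[OF assms(1)])
  moreover have "blinfun_apply T x = 0" if "k \<in> I - {j}" "x \<in> X k" for k x
  proof -
    have "cmp j x = 0" using that assms component_in[of j k x] by auto
    then show ?thesis by (subst eq) (simp add: component_zero[OF assms(1)])
  qed
  ultimately show "T \<in> blocks n X i j"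
    using T by (auto simp: blocks_def clin_iff_linear)
qed

text \<open>With inverse \<open>tot\<close>, this is the isomorphism between the complex linear
  bounded operators and the matrix algebra. Entries off the index range are 0 as
  \<open>opmats\<close> demands.\<close>

definition cut :: "('a \<Rightarrow>\<^sub>L 'a) \<Rightarrow> 'a opmat" where
  "cut T = (\<lambda>i j. if i \<in> I \<and> j \<in> I then P i o\<^sub>L (T o\<^sub>L P j) else 0)"

definition tot :: "'a opmat \<Rightarrow> 'a \<Rightarrow>\<^sub>L 'a" where
  "tot M = (\<Sum>i\<in>I. \<Sum>j\<in>I. M i j)"

lemma cut_opmats: "clin T \<Longrightarrow> cut T \<in> opmats n X"
  by (auto simp: opmats_def cut_def blocks_iff clin_intros clin_P P_idem blinfun_compose_assoc P_compose)

lemma tot_cut: "tot (cut T) = T"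
proof -
  have "tot (cut T) = (\<Sum>i\<in>I. P i) o\<^sub>L (T o\<^sub>L (\<Sum>j\<in>I. P j))"
    unfolding compose_sum_left compose_sum_right by (subst sum.swap) (simp add: tot_def cut_def)
  then show ?thesis by (simp add: P_sum)
qed

lemma
  assumes "M \<in> opmats n X"
  shows clin_tot: "clin (tot M)" and cut_tot: "cut (tot M) = M"
proof -
  have M: "clin (M i j)" "P i o\<^sub>L (M i j o\<^sub>L P j) = M i j" if "i \<in> I" "j \<in> I" for i j
  proof -
    have "M i j \<in> blocks n X i j" using assms that by (simp add: opmats_def)
    then show "clin (M i j)" "P i o\<^sub>L (M i j o\<^sub>L P j) = M i j" using blocks_iff[OF that] by auto
  qed
  show "clin (tot M)" unfolding tot_def using M by (intro clin_sum)
  have "P i o\<^sub>L (tot M o\<^sub>L P j) = M i j" if ij: "i \<in> I" "j \<in> I" for i j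
  proof -
    have "P i o\<^sub>L (M k l o\<^sub>L P j) = (if k = i \<and> l = j then M i j else 0)" if "k \<in> I" "l \<in> I" for k l
    proof -
      have "P i o\<^sub>L (M k l o\<^sub>L P j) = (P i o\<^sub>L P k) o\<^sub>L (M k l o\<^sub>L (P l o\<^sub>L P j))"
        using M(2)[OF that] by (metis blinfun_compose_assoc)
      then show ?thesis using that ij M(2) by (auto simp: P_compose)
    qed
    then have "P i o\<^sub>L (tot M o\<^sub>L P j) = (\<Sum>k\<in>I. \<Sum>l\<in>I. if k = i \<and> l = j then M i j else 0)"
      unfolding tot_def compose_sum_left compose_sum_right by (intro sum.cong) auto
    also have "\<dots> = (\<Sum>k\<in>I. if k = i then M i j else 0)"
      using ij by (intro sum.cong) auto
    finally show ?thesis using ij by simp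
  qed
  moreover have "M i j = 0" if "\<not> (i \<in> I \<and> j \<in> I)" for i j
    using assms that by (auto simp: opmats_def split: if_splits)
  ultimately show "cut (tot M) = M" by (auto simp: cut_def fun_eq_iff)
qed

lemma cut_inject: "cut S = cut T \<longleftrightarrow> S = T"
  by (metis tot_cut)

text \<open>Insert the identity, as the sum of the projections \<open>P k\<close>, between
  \<open>S\<close> and \<open>T\<close>.\<close>

lemma cut_compose:
  assumes "i \<in> I" "j \<in> I" shows "(\<Sum>k\<in>I. cut S i k o\<^sub>L cut T k j) = cut (S o\<^sub>L T) i j"
proof -
  have "(\<Sum>k\<in>I. cut S i k o\<^sub>L cut T k j) = (\<Sum>k\<in>I. P i o\<^sub>L (S o\<^sub>L (P k o\<^sub>L (T o\<^sub>L P j))))"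
    using assms by (intro sum.cong) (simp_all add: cut_def blinfun_compose_assoc P_idem)
  also have "\<dots> = P i o\<^sub>L (S o\<^sub>L ((\<Sum>k\<in>I. P k) o\<^sub>L (T o\<^sub>L P j)))"
    unfolding compose_sum_left compose_sum_right ..
  finally show ?thesis using assms by (simp add: P_sum cut_def blinfun_compose_assoc)
qed

lemma mat_mult_cut: "mat_mult n (cut S) (cut T) = cut (S o\<^sub>L T)"
  using cut_compose by (fastforce simp: mat_mult_def cut_def fun_eq_iff)

lemma mat_one_cut: "mat_one n X = cut id_op"
  by (auto simp: mat_one_def cut_def fun_eq_iff P_compose)

lemma cut_shift: "i \<in> I \<Longrightarrow> j \<in> I \<Longrightarrow>
    cut (z *\<^sub>C id_op - T) i j = (if i = j then z *\<^sub>C P i else 0) - cut T i j"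
  by (simp add: cut_def blinfun_compose_distrib(3) blinfun_compose_distrib(4)[of "P i"]
      blinfun_compose_scaleC_right clin_P P_compose)

lemma shifted_cut: "shifted n X (cut T) z = cut (z *\<^sub>C id_op - T)"
proof (intro ext)
  fix i j
  show "shifted n X (cut T) z i j = cut (z *\<^sub>C id_op - T) i j"
    using cut_shift[of i j z T] by (cases "i \<in> I \<and> j \<in> I") (auto simp: shifted_def mat_one_def cut_def)
qed

lemma is_inverse_in_cut:
  assumes "\<A> \<subseteq> opmats n X"
  shows "is_inverse_in \<A> n X (cut T) M \<longleftrightarrow> (\<exists>S. M = cut S \<and> cut S \<in> \<A> \<and> op_inverse S T)"
proof -
  have "M = cut (tot M)" if "M \<in> \<A>" using that assms cut_tot by auto
  then show ?thesis
    unfolding is_inverse_in_def op_inverse_def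
    by (metis mat_mult_cut mat_one_cut cut_inject)
qed

definition lower :: "('a \<Rightarrow>\<^sub>L 'a) set" where
  "lower = {T. clin T \<and> (\<forall>i\<in>I. \<forall>j\<in>I. i < j \<longrightarrow> P i o\<^sub>L (T o\<^sub>L P j) = 0)}"

lemma cut_opmats_iff: "cut T \<in> opmats n X \<longleftrightarrow> clin T"
  using cut_opmats clin_tot by (metis tot_cut)

lemma cut_lower_iff: "cut T \<in> lower_opmats n X \<longleftrightarrow> T \<in> lower"
  unfolding lower_opmats_def lower_def mem_Collect_eq cut_opmats_iff by (auto simp: cut_def)

lemma cut_lower_eq_0: "T \<in> lower \<Longrightarrow> i < j \<Longrightarrow> cut T i j = 0"
  by (auto simp: lower_def cut_def)

sublocale L: operator_algebra lower
proof
  show "closed lower"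
    unfolding lower_def Ball_def
    by (intro closed_Collect_conj closed_clin closed_Collect_all closed_Collect_imp
        closed_Collect_eq continuous_intros open_Collect_const
        bounded_linear.continuous_on[OF bounded_linear_compose_left]
        bounded_linear.continuous_on[OF bounded_linear_compose_right])
next
  fix S T assume ST: "S \<in> lower" "T \<in> lower"
  have "cut (S o\<^sub>L T) i j = 0" if "i \<in> I" "j \<in> I" "i < j" for i j
  proof -
    \<comment> \<open>For \<open>i < j\<close>, every \<open>k\<close> satisfies
      \<open>i < k\<close> or \<open>k < j\<close>, so one of the factors vanishes.\<close>
    have "cut S i k o\<^sub>L cut T k j = 0" for k
      using that cut_lower_eq_0[OF ST(1), of i k] cut_lower_eq_0[OF ST(2), of k j]
      by (cases "i < k") auto
    then show ?thesis using cut_compose[OF that(1,2), of S T] by simp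
  qed
  then show "S o\<^sub>L T \<in> lower" using ST by (auto simp: lower_def cut_def clin_intros)
qed (auto simp: lower_def clin_intros P_compose blinfun_compose_distrib blinfun_compose_scaleC_right clin_P)

end

section \<open>Block resolvents of lower triangular matrices\<close>

lemma C1_holomorphic_compose:
  assumes "C1_holomorphic F S" "C1_holomorphic G S" "\<And>z. z \<in> S \<Longrightarrow> clin (F z)"
  shows "C1_holomorphic (\<lambda>z. F z o\<^sub>L G z) S"
proof -
  obtain F' where F': "continuous_on S F'"
    "\<And>z. z \<in> S \<Longrightarrow> (F has_derivative (\<lambda>h. h *\<^sub>C F' z)) (at z)"
    using assms(1) by (rule C1_holomorphicE) blast
  obtain G' where G': "continuous_on S G'"
    "\<And>z. z \<in> S \<Longrightarrow> (G has_derivative (\<lambda>h. h *\<^sub>C G' z)) (at z)"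
    using assms(2) by (rule C1_holomorphicE) blast
  have "((\<lambda>z. F z o\<^sub>L G z) has_derivative (\<lambda>h. h *\<^sub>C ((F z o\<^sub>L G' z) + (F' z o\<^sub>L G z)))) (at z)"
    if "z \<in> S" for z
    using bounded_bilinear.FDERIV[OF bounded_bilinear_blinfun_compose F'(2)[OF that] G'(2)[OF that]]
    by (simp add: blinfun_compose_scaleC_right[OF assms(3)[OF that]] scaleC_add_right)
  moreover have "continuous_on S (\<lambda>z. (F z o\<^sub>L G' z) + (F' z o\<^sub>L G z))"
    by (intro continuous_intros bounded_bilinear.continuous_on[OF bounded_bilinear_blinfun_compose]
        F' G' C1_holomorphic_continuous_on assms)
  ultimately show ?thesis unfolding C1_holomorphic_def by blast
qed

section \<open>Decreasing index sequences\<close>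

lemma decreasing_seqs_self: "decreasing_seqs i i = {[i]}"
proof -
  have "is = [i]" if "is \<in> decreasing_seqs i i" for "is"
  proof (cases "is")
    case (Cons a as)
    then show ?thesis using that by (cases "as = []") (auto simp: decreasing_seqs_def dest: last_in_set)
  qed (use that in \<open>simp add: decreasing_seqs_def\<close>)
  then show ?thesis by (auto simp: decreasing_seqs_def)
qed

text \<open>Sorting the sequences by their second entry matches the recurrence for the entries of
  the resolvent.\<close>

lemma decreasing_seqs_step:
  assumes "j < i"
  shows "decreasing_seqs i j = (\<Union>k\<in>{j..<i}. (#) i ` decreasing_seqs k j)"
proof (intro set_eqI iffI)
  fix "is" assume s: "is \<in> decreasing_seqs i j"
  then obtain as where as: "is = i # as" unfolding decreasing_seqs_def by (cases "is") auto
  with s assms obtain k bs where "as = k # bs" by (cases as) (auto simp: decreasing_seqs_def)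
  with s as have "k < i" "as \<in> decreasing_seqs k j"
    by (auto simp: decreasing_seqs_def)
  moreover from this have "j \<le> k"
    using last_in_set[of bs] \<open>as = k # bs\<close> by (cases "bs = []") (auto simp: decreasing_seqs_def)
  ultimately show "is \<in> (\<Union>k\<in>{j..<i}. (#) i ` decreasing_seqs k j)"
    using as by auto
next
  fix "is" assume "is \<in> (\<Union>k\<in>{j..<i}. (#) i ` decreasing_seqs k j)"
  then obtain k as where "k < i" "is = i # as" "as \<in> decreasing_seqs k j" by auto
  then show "is \<in> decreasing_seqs i j"
    by (cases as) (auto simp: decreasing_seqs_def)
qed

lemma finite_decreasing_seqs: "j \<le> i \<Longrightarrow> finite (decreasing_seqs i j)"
proof (induction i rule: less_induct)
  case (less i)
  then show ?case
    by (cases "i = j") (auto simp: decreasing_seqs_self decreasing_seqs_step)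
qed

lemma set_decreasing_seqs:
  assumes "is \<in> decreasing_seqs i j" shows "set is \<subseteq> {j..i}" "is \<noteq> []"
proof -
  show "is \<noteq> []" using assms by (simp add: decreasing_seqs_def)
  then show "set is \<subseteq> {j..i}" using assms
  proof (induction "is" arbitrary: i rule: list_nonempty_induct)
    case (cons x xs)
    then have "set xs \<subseteq> {j..hd xs}" "hd xs < x" "x = i"
      by (auto simp: decreasing_seqs_def)
    moreover from this have "j \<le> hd xs" using hd_in_set[OF cons(1)] by auto
    ultimately show ?case by fastforce
  qed (auto simp: decreasing_seqs_def)
qed

section \<open>Entries of the resolvent on the causal resolvent set\<close>

locale lower_matrix = direct_sum n X for n and X :: "nat \<Rightarrow> 'a::complex_banach set" +
  fixes A :: "'a opmat" and B :: "'a \<Rightarrow>\<^sub>L 'a"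
  assumes A_eq: "A = cut B" and B_lower: "B \<in> lower"
begin

lemma clin_B: "clin B"
  using B_lower by (rule L.clin_mem)

lemma spec_iff: "z \<in> spec n X A \<longleftrightarrow> z \<notin> clin.resolvent_set B"
  unfolding spectrum_in_def A_eq shifted_cut is_inverse_in_cut[OF order_refl]
  by (auto simp: clin.resolvent_set_def cut_opmats_iff)

lemma lower_opmats_subset: "lower_opmats n X \<subseteq> opmats n X"
  by (auto simp: lower_opmats_def)

lemma causal_spec_iff: "z \<in> causal_spec n X A \<longleftrightarrow> z \<notin> L.resolvent_set B"
  unfolding spectrum_in_def A_eq shifted_cut is_inverse_in_cut[OF lower_opmats_subset]
  by (auto simp: L.resolvent_set_def cut_lower_iff)

lemma resolvent_eq:
  assumes "z \<in> clin.resolvent_set B" shows "resolvent n X A z = cut (res B z)"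
  unfolding resolvent_def A_eq shifted_cut is_inverse_in_cut[OF order_refl]
  using res_inverse[OF assms] by (intro the_equality) (auto simp: cut_opmats_iff dest: res_eqI)

lemma
  assumes z: "z \<in> L.resolvent_set B"
  shows L_resolvent: "z \<in> clin.resolvent_set B" and res_lower: "res B z \<in> lower"
  using z L.resolvent_set_iff by auto

lemma cut_res_shift:
  assumes z: "z \<in> L.resolvent_set B" and ij: "i \<in> I" "j \<in> I"
  shows "(\<Sum>k\<in>I. cut (res B z) i k o\<^sub>L cut (z *\<^sub>C id_op - B) k j) = (if i = j then P i else 0)"
    and "(\<Sum>k\<in>I. cut (z *\<^sub>C id_op - B) i k o\<^sub>L cut (res B z) k j) = (if i = j then P i else 0)"
  using res_inverse(1)[OF L_resolvent[OF z]] mat_one_cut cut_compose[OF ij] ij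
  by (simp_all add: op_inverse_def cut_def P_compose)

lemma shift_lower: "z *\<^sub>C id_op - B \<in> lower"
  using L.add_mem[OF L.scale_mem[OF L.id_mem, of z] L.scale_mem[OF B_lower, of "- 1"]]
  by (simp add: scaleC.minus_left scaleC_one)

text \<open>In a diagonal entry of a product of lower triangular matrices only the summand
  \<open>k = i\<close> survives. So off the causal spectrum every diagonal block of the shifted
  matrix is invertible.\<close>

lemma diagonal_inverse:
  assumes z: "z \<in> L.resolvent_set B" and i: "i \<in> I"
  shows "cut (res B z) i i o\<^sub>L (z *\<^sub>C P i - A i i) = P i"
    and "(z *\<^sub>C P i - A i i) o\<^sub>L cut (res B z) i i = P i"
proof -
  let ?S = "z *\<^sub>C id_op - B"
  have S: "cut ?S i i = z *\<^sub>C P i - A i i" using cut_shift[OF i i] by (simp add: A_eq)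
  have "cut (res B z) i k o\<^sub>L cut ?S k i = (if k = i then cut (res B z) i i o\<^sub>L cut ?S i i else 0)" for k
    using cut_lower_eq_0[OF res_lower[OF z], of i k] cut_lower_eq_0[OF shift_lower, of k i z]
    by (cases k i rule: linorder_cases) auto
  then show "cut (res B z) i i o\<^sub>L (z *\<^sub>C P i - A i i) = P i"
    using cut_res_shift(1)[OF z i i] i S by simp
  have "cut ?S i k o\<^sub>L cut (res B z) k i = (if k = i then cut ?S i i o\<^sub>L cut (res B z) i i else 0)" for k
    using cut_lower_eq_0[OF res_lower[OF z], of k i] cut_lower_eq_0[OF shift_lower, of i k z]
    by (cases k i rule: linorder_cases) auto
  then show "(z *\<^sub>C P i - A i i) o\<^sub>L cut (res B z) i i = P i"
    using cut_res_shift(2)[OF z i i] i S by simp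
qed

lemma block_resolvent_eq:
  assumes z: "z \<in> L.resolvent_set B" and i: "i \<in> I"
  shows "block_resolvent n X A i z = cut (res B z) i i"
  unfolding block_resolvent_def
proof (rule the_equality)
  let ?R = "cut (res B z) i i"
  have "cut (res B z) \<in> opmats n X"
    using cut_opmats L.clin_mem[OF res_lower[OF z]] by blast
  then have "?R \<in> blocks n X i i" using i by (simp add: opmats_def)
  with diagonal_inverse[OF z i]
  show "?R \<in> blocks n X i i \<and> ?R o\<^sub>L (z *\<^sub>C P i - A i i) = P i \<and> (z *\<^sub>C P i - A i i) o\<^sub>L ?R = P i"
    by simp
  fix S assume S: "S \<in> blocks n X i i \<and> S o\<^sub>L (z *\<^sub>C P i - A i i) = P i \<and> (z *\<^sub>C P i - A i i) o\<^sub>L S = P i"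
  then have S': "P i o\<^sub>L (S o\<^sub>L P i) = S" using blocks_iff[OF i i] by simp
  \<comment> \<open>Uniqueness of inverses in the corner algebra, whose unit is
    \<open>P i\<close>.\<close>
  have "S = S o\<^sub>L P i" using S' by (metis P_compose[OF i i] blinfun_compose_assoc)
  also have "\<dots> = (S o\<^sub>L (z *\<^sub>C P i - A i i)) o\<^sub>L ?R"
    using diagonal_inverse(2)[OF z i] by (simp only: blinfun_compose_assoc)
  also have "\<dots> = P i o\<^sub>L ?R" using S by simp
  also have "\<dots> = ?R" using i by (simp add: cut_def P_idem)
  finally show "S = ?R" .
qed

text \<open>Entry \<open>(i, j)\<close> of \<open>(z - B) res B z = 1\<close> is 0 below the
  diagonal. Isolating the summand \<open>k = i\<close> and applying the inverse of the diagonal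
  block solves for the entry of row \<open>i\<close> in terms of higher rows.\<close>

lemma resolvent_recurrence:
  assumes z: "z \<in> L.resolvent_set B" and ij: "i \<in> I" "j \<in> I" "j < i"
  shows "cut (res B z) i j = (\<Sum>k\<in>{j..<i}. cut (res B z) i i o\<^sub>L A i k o\<^sub>L cut (res B z) k j)"
proof -
  let ?R = "cut (res B z)" and ?S = "cut (z *\<^sub>C id_op - B)"
  have S: "?S i k = (if k = i then z *\<^sub>C P i - A i i else - A i k)" if "k \<in> I" for k
    using cut_shift[OF ij(1) that, of z B] by (auto simp: A_eq)
  have sub: "insert i {j..<i} \<subseteq> I" using ij by auto
  have "0 = (\<Sum>k\<in>I. ?S i k o\<^sub>L ?R k j)" using cut_res_shift(2)[OF z ij(1,2)] ij by simp
  also have "\<dots> = (\<Sum>k\<in>insert i {j..<i}. ?S i k o\<^sub>L ?R k j)"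
  \<comment> \<open>Summands with \<open>k < j\<close> vanish because the resolvent is lower
    triangular, those with \<open>k > i\<close> because the shifted matrix is.\<close>
  proof (rule sum.mono_neutral_right[OF _ sub], simp, rule ballI)
    fix k assume "k \<in> I - insert i {j..<i}"
    then have "k < j \<or> i < k" using ij by auto
    then show "?S i k o\<^sub>L ?R k j = 0"
      using cut_lower_eq_0[OF res_lower[OF z], of k j] cut_lower_eq_0[OF shift_lower, of i k z] by auto
  qed
  also have "\<dots> = ((z *\<^sub>C P i - A i i) o\<^sub>L ?R i j) + (\<Sum>k\<in>{j..<i}. ?S i k o\<^sub>L ?R k j)"
    using S[OF ij(1)] by simp
  also have "(\<Sum>k\<in>{j..<i}. ?S i k o\<^sub>L ?R k j) = - (\<Sum>k\<in>{j..<i}. A i k o\<^sub>L ?R k j)"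
    unfolding sum_negf[symmetric] using S sub
    by (intro sum.cong) (auto simp: blinfun_compose_distrib(5))
  finally have eq: "(z *\<^sub>C P i - A i i) o\<^sub>L ?R i j = (\<Sum>k\<in>{j..<i}. A i k o\<^sub>L ?R k j)"
    by simp
  have "?R i j = P i o\<^sub>L ?R i j" using ij by (simp add: cut_def P_idem)
  also have "\<dots> = (?R i i o\<^sub>L (z *\<^sub>C P i - A i i)) o\<^sub>L ?R i j"
    by (simp only: diagonal_inverse(1)[OF z ij(1)])
  also have "\<dots> = ?R i i o\<^sub>L ((z *\<^sub>C P i - A i i) o\<^sub>L ?R i j)"
    by (rule blinfun_compose_assoc)
  finally show ?thesis by (simp only: eq compose_sum_right blinfun_compose_assoc)
qed

lemma resolvent_chain_sum:
  assumes z: "z \<in> L.resolvent_set B" and j: "j \<in> I"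
  shows "i \<in> I \<Longrightarrow> j \<le> i \<Longrightarrow>
    cut (res B z) i j = (\<Sum>is\<in>decreasing_seqs i j. resolvent_chain n X A z is)"
proof (induction i rule: less_induct)
  case (less i)
  show ?case
  proof (cases "i = j")
    case True
    then show ?thesis using block_resolvent_eq[OF z j] by (simp add: decreasing_seqs_self)
  next
    case False
    then have ji: "j < i" using less.prems by simp
    let ?b = "block_resolvent n X A i z"
    have "(\<Sum>is\<in>decreasing_seqs i j. resolvent_chain n X A z is)
        = (\<Sum>k\<in>{j..<i}. \<Sum>is\<in>(#) i ` decreasing_seqs k j. resolvent_chain n X A z is)"
      unfolding decreasing_seqs_step[OF ji]
    proof (rule sum.UNION_disjoint)
      show "\<forall>k\<in>{j..<i}. finite ((#) i ` decreasing_seqs k j)"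
        by (simp add: finite_decreasing_seqs)
      show "\<forall>k\<in>{j..<i}. \<forall>l\<in>{j..<i}. k \<noteq> l \<longrightarrow>
          (#) i ` decreasing_seqs k j \<inter> (#) i ` decreasing_seqs l j = {}"
        by (auto simp: decreasing_seqs_def)
    qed simp
    also have "\<dots> = (\<Sum>k\<in>{j..<i}. ?b o\<^sub>L A i k o\<^sub>L cut (res B z) k j)"
    proof (rule sum.cong[OF refl])
      fix k assume k: "k \<in> {j..<i}"
      have "(\<Sum>is\<in>(#) i ` decreasing_seqs k j. resolvent_chain n X A z is)
          = (\<Sum>is\<in>decreasing_seqs k j. resolvent_chain n X A z (i # is))"
        by (simp add: sum.reindex)
      also have "\<dots> = (\<Sum>is\<in>decreasing_seqs k j. ?b o\<^sub>L A i k o\<^sub>L resolvent_chain n X A z is)"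
      \<comment> \<open>The chain recursion needs a visible second entry; every list from
        \<open>k\<close> to \<open>j\<close> starts with \<open>k\<close>.\<close>
      proof (rule sum.cong[OF refl])
        fix "is" assume "is \<in> decreasing_seqs k j"
        then obtain as where "is = k # as" unfolding decreasing_seqs_def by (cases "is") auto
        then show "resolvent_chain n X A z (i # is) = ?b o\<^sub>L A i k o\<^sub>L resolvent_chain n X A z is"
          by simp
      qed
      also have "\<dots> = ?b o\<^sub>L A i k o\<^sub>L cut (res B z) k j"
        using less.IH[of k] k less.prems j by (simp add: compose_sum_right)
      finally show "(\<Sum>is\<in>(#) i ` decreasing_seqs k j. resolvent_chain n X A z is)
          = ?b o\<^sub>L A i k o\<^sub>L cut (res B z) k j" .
    qed
    finally show ?thesis
      using resolvent_recurrence[OF z less.prems(1) j ji] block_resolvent_eq[OF z less.prems(1)] by simp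
  qed
qed

lemma bounded_linear_corner: "bounded_linear (\<lambda>T. cut T i j)"
  unfolding cut_def
  using bounded_linear_compose[OF bounded_linear_compose_right bounded_linear_compose_left]
  by (cases "i \<in> I \<and> j \<in> I") auto

lemma cut_scaleC: "cut (c *\<^sub>C T) i j = c *\<^sub>C cut T i j"
  by (simp add: cut_def blinfun_compose_scaleC_right clin_P)

lemma L_resolvent_subset: "L.resolvent_set B \<subseteq> clin.resolvent_set B"
  using L_resolvent by blast

text \<open>Supplies the integrability that allows the sum over index sequences to be taken out of
  the integral.\<close>

lemma C1_holomorphic_resolvent_chain:
  "is \<noteq> [] \<Longrightarrow> set is \<subseteq> I \<Longrightarrow> C1_holomorphic (\<lambda>z. resolvent_chain n X A z is) (L.resolvent_set B)"
proof (induction "is" rule: list_nonempty_induct)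
  have hol: "C1_holomorphic (block_resolvent n X A i) (L.resolvent_set B)" if "i \<in> I" for i
  proof -
    have "C1_holomorphic (\<lambda>z. cut (res B z) i i) (L.resolvent_set B)"
      by (rule C1_holomorphic_bounded_linear[OF _ bounded_linear_corner cut_scaleC])
        (rule C1_holomorphic_subset[OF C1_holomorphic_res[OF clin_B] L_resolvent_subset])
    then show ?thesis
      by (rule C1_holomorphic_cong_open[OF _ L.open_resolvent_set[OF clin_B]])
        (simp add: block_resolvent_eq[OF _ that])
  qed
  have clinA: "clin (A i j)" for i j
    using clin_B by (cases "i \<in> I \<and> j \<in> I") (auto simp: A_eq cut_def intro!: clin_intros clin_P)
  {
    case (single i)
    then show ?case using hol[of i] by simp
  next
    case (cons i "is")
    then obtain k as where s: "is = k # as" by (cases "is") auto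
    have i: "i \<in> I" using cons by simp
    have b: "clin (block_resolvent n X A i z)" if "z \<in> L.resolvent_set B" for z
      using that i L.clin_mem[OF res_lower[OF that]]
      by (simp add: block_resolvent_eq cut_def clin_intros clin_P)
    have "C1_holomorphic (\<lambda>z. (block_resolvent n X A i z o\<^sub>L A i k) o\<^sub>L resolvent_chain n X A z is) (L.resolvent_set B)"
      using cons by (intro C1_holomorphic_compose hol C1_holomorphic_const clin_intros b clinA) auto
    then show ?case by (simp add: s)
  }
qed

text \<open>The integral over the chosen contour \<open>\<Gamma>\<close> around the spectrum is
  moved to the chosen contour \<open>\<Gamma>'\<close> around the causal spectrum. Bounded linear
  maps commute with the integral, so every property of the integrand along \<open>\<Gamma>'\<close>
  passes to \<open>E\<close>.\<close>

theorem func_calc_lower: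
  assumes D: "convex_components D" "f holomorphic_on D"
    and ex: "\<exists>\<Gamma>. surrounds D \<Gamma> (causal_spec n X A)"
  shows "func_calc n X D f A \<in> lower_opmats n X"
    and "i \<in> I \<Longrightarrow> j \<in> {1..i} \<Longrightarrow>
      func_calc n X D f A i j = (\<Sum>is\<in>decreasing_seqs i j. divdiff_calc n X D f A is)"
proof -
  define \<Gamma> where "\<Gamma> = (SOME \<Gamma>. surrounds D \<Gamma> (spec n X A))"
  define \<Gamma>' where "\<Gamma>' = (SOME \<Gamma>. surrounds D \<Gamma> (causal_spec n X A))"
  let ?R = "clin.resolvent_set B" and ?L = "L.resolvent_set B"
  let ?F = "\<lambda>z. f z *\<^sub>C res B z"
  have sub: "spec n X A \<subseteq> causal_spec n X A"
    using spec_iff causal_spec_iff L_resolvent by blast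
  have \<Gamma>': "surrounds D \<Gamma>' (causal_spec n X A)"
    unfolding \<Gamma>'_def using ex by (rule someI_ex)
  \<comment> \<open>A contour around the larger set also surrounds the smaller one, so both choices
    of contour are meaningful.\<close>
  then have "\<exists>\<Gamma>. surrounds D \<Gamma> (spec n X A)"
    using sub unfolding surrounds_def by blast
  then have \<Gamma>: "surrounds D \<Gamma> (spec n X A)"
    unfolding \<Gamma>_def by (rule someI_ex)
  have curve: "closed_curve_in (D \<inter> ?R) \<gamma>" if "\<gamma> \<in> set \<Gamma>" for \<gamma>
    using \<Gamma> that spec_iff unfolding surrounds_def closed_curve_in_def by blast
  have curve': "closed_curve_in (D \<inter> ?L) \<gamma>" if "\<gamma> \<in> set \<Gamma>'" for \<gamma>
    using \<Gamma>' that causal_spec_iff unfolding surrounds_def closed_curve_in_def by blast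
  have oR: "open (D \<inter> ?R)" "open (D \<inter> ?L)"
    using D(1) clin.open_resolvent_set[OF clin_B] L.open_resolvent_set[OF clin_B]
    by (auto simp: convex_components_def)
  have integrable: "path_integrand \<gamma> G integrable_on {0..1}"
    if "closed_curve_in U \<gamma>" "open U" "C1_holomorphic G U" for \<gamma> U and G :: "complex \<Rightarrow> 'a \<Rightarrow>\<^sub>L 'a"
    using path_integrand_integrable that by (auto simp: closed_curve_in_def)
  have FR: "C1_holomorphic ?F (D \<inter> ?R)"
    by (intro C1_holomorphic_scaleC oR holomorphic_on_subset[OF D(2)]
        C1_holomorphic_subset[OF C1_holomorphic_res[OF clin_B]]) auto
  have FL: "C1_holomorphic ?F (D \<inter> ?L)"
    using FR by (rule C1_holomorphic_subset) (use L_resolvent in auto)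
  note intF = integrable[OF curve oR(1) FR] and intF' = integrable[OF curve' oR(2) FL]
  define E where "E = cauchy_integral \<Gamma> ?F"
  have E': "E = cauchy_integral \<Gamma>' ?F"
    unfolding E_def
  proof (rule cauchy_integral_resolvent_independent[OF clin_B D curve])
    show "closed_curve_in (D \<inter> ?R) \<gamma>" if "\<gamma> \<in> set \<Gamma>'" for \<gamma>
      using curve'[OF that] L_resolvent by (auto simp: closed_curve_in_def)
    fix z assume "z \<notin> ?R"
    then have "z \<in> spec n X A" "z \<in> causal_spec n X A" using spec_iff sub by auto
    then show "(\<Sum>\<gamma>\<leftarrow>\<Gamma>. winding_number \<gamma> z) = (\<Sum>\<gamma>\<leftarrow>\<Gamma>'. winding_number \<gamma> z)"
      using \<Gamma> \<Gamma>' by (simp add: surrounds_def)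
  qed
  have cutE': "cauchy_integral \<Gamma>' (\<lambda>z. cut (?F z) i j) = cut E i j" for i j
    unfolding E' by (rule cauchy_integral_linear[OF intF' bounded_linear_corner cut_scaleC])
  have "func_calc n X D f A i j = cut E i j" for i j
  proof -
    have "func_calc n X D f A i j = cauchy_integral \<Gamma> (\<lambda>z. cut (?F z) i j)"
      unfolding func_calc_def Let_def \<Gamma>_def[symmetric] cut_scaleC
    proof (rule cauchy_integral_cong)
      fix \<gamma> z assume "\<gamma> \<in> set \<Gamma>" "z \<in> path_image \<gamma>"
      then have "z \<in> ?R" using curve by (auto simp: closed_curve_in_def)
      then show "f z *\<^sub>C resolvent n X A z i j = f z *\<^sub>C cut (res B z) i j"
        by (simp add: resolvent_eq)
    qed
    also have "\<dots> = cut E i j"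
      unfolding E_def by (rule cauchy_integral_linear[OF intF bounded_linear_corner cut_scaleC])
    finally show ?thesis .
  qed
  then have func: "func_calc n X D f A = cut E" by blast
  have zero: "cauchy_integral \<Gamma>' (\<lambda>_. 0 :: 'a \<Rightarrow>\<^sub>L 'a) = 0"
    using cauchy_integral_sum[of \<Gamma>' "{}"] by simp
  have on_L: "z \<in> ?L" if "\<gamma> \<in> set \<Gamma>'" "z \<in> path_image \<gamma>" for \<gamma> z
    using curve'[OF that(1)] that(2) by (auto simp: closed_curve_in_def)
  have "clin E"
    unfolding clin_def
  proof (intro allI)
    fix c x
    \<comment> \<open>Complex linearity of \<open>E\<close> for a fixed scalar \<open>c\<close>,
      phrased as the vanishing of a bounded linear map that kills the integrand.\<close>
    let ?l = "\<lambda>T :: 'a \<Rightarrow>\<^sub>L 'a. (T o\<^sub>L (c *\<^sub>C id_op)) - c *\<^sub>C T"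
    have bl: "bounded_linear ?l"
      by (intro bounded_linear_sub bounded_linear_compose_left bounded_linear_scaleC)
    have hom: "?l (d *\<^sub>C T) = d *\<^sub>C ?l T" for d T
      by (simp add: scaleC.diff_right scaleC_scaleC mult.commute)
    have "?l E = cauchy_integral \<Gamma>' (\<lambda>z. ?l (?F z))"
      unfolding E' by (rule cauchy_integral_linear[where L = ?l, OF intF' bl hom, symmetric])
    also have "\<dots> = cauchy_integral \<Gamma>' (\<lambda>_. 0)"
      using L.clin_mem[OF res_lower[OF on_L]]
      by (intro cauchy_integral_cong)
        (simp add: blinfun_compose_scaleC_right scaleC_scaleC mult.commute)
    finally have "E o\<^sub>L (c *\<^sub>C id_op) = c *\<^sub>C E" by (simp add: zero)
    then have "blinfun_apply (E o\<^sub>L (c *\<^sub>C id_op)) x = blinfun_apply (c *\<^sub>C E) x" by simp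
    then show "blinfun_apply E (c *\<^sub>C x) = c *\<^sub>C blinfun_apply E x"
      by (simp add: scaleC_blinfun.rep_eq)
  qed
  have cut0: "cut E i j = 0" if "i < j" for i j
  proof -
    have "cut E i j = cauchy_integral \<Gamma>' (\<lambda>_. 0)"
      unfolding cutE'[symmetric]
      by (rule cauchy_integral_cong) (simp add: cut_scaleC cut_lower_eq_0[OF res_lower[OF on_L] that])
    then show ?thesis by (simp add: zero)
  qed
  have "P i o\<^sub>L (E o\<^sub>L P j) = 0" if "i \<in> I" "j \<in> I" "i < j" for i j
    using cut0[OF that(3)] that by (simp add: cut_def)
  with \<open>clin E\<close> have "E \<in> lower" unfolding lower_def by blast
  then show "func_calc n X D f A \<in> lower_opmats n X" by (simp add: func cut_lower_iff)
  assume i: "i \<in> I" and ji: "j \<in> {1..i}"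
  then have j: "j \<in> I" "j \<le> i" by auto
  have "cut E i j = cauchy_integral \<Gamma>' (\<lambda>z. \<Sum>is\<in>decreasing_seqs i j. f z *\<^sub>C resolvent_chain n X A z is)"
    unfolding cutE'[symmetric]
    by (rule cauchy_integral_cong)
      (simp add: cut_scaleC resolvent_chain_sum[OF on_L j(1) i j(2)] scaleC.sum_right)
  also have "\<dots> = (\<Sum>is\<in>decreasing_seqs i j. cauchy_integral \<Gamma>' (\<lambda>z. f z *\<^sub>C resolvent_chain n X A z is))"
  proof (rule cauchy_integral_sum)
    fix \<gamma> "is" assume g: "\<gamma> \<in> set \<Gamma>'" and s: "is \<in> decreasing_seqs i j"
    have "set is \<subseteq> I" using set_decreasing_seqs(1)[OF s] i j by fastforce
    then have "C1_holomorphic (\<lambda>z. resolvent_chain n X A z is) ?L"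
      by (rule C1_holomorphic_resolvent_chain[OF set_decreasing_seqs(2)[OF s]])
    then have "C1_holomorphic (\<lambda>z. f z *\<^sub>C resolvent_chain n X A z is) (D \<inter> ?L)"
      by (intro C1_holomorphic_scaleC oR holomorphic_on_subset[OF D(2)]) (auto elim: C1_holomorphic_subset)
    then show "path_integrand \<gamma> (\<lambda>z. f z *\<^sub>C resolvent_chain n X A z is) integrable_on {0..1}"
      by (rule integrable[OF curve'[OF g] oR(2)])
  qed
  finally show "func_calc n X D f A i j = (\<Sum>is\<in>decreasing_seqs i j. divdiff_calc n X D f A is)"
    by (simp add: func divdiff_calc_def \<Gamma>'_def)
qed

section \<open>Existence of contours\<close>

lemma closed_causal_spec: "closed (causal_spec n X A)"
proof -
  have "causal_spec n X A = - L.resolvent_set B" using causal_spec_iff by blast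
  then show ?thesis using L.open_resolvent_set[OF clin_B] by auto
qed

lemma causal_spec_bound: "z \<in> causal_spec n X A \<Longrightarrow> cmod z \<le> norm B"
  using L.resolvent_set_large[OF B_lower] causal_spec_iff by (meson not_less)

text \<open>\<open>S\<close> is open because the resolvent set of the lower triangular algebra is
  open. It is closed because the resolvent is continuous along the whole axis and
  \<open>lower\<close> is closed. The line is connected.\<close>

lemma causal_spec_imaginary_axis:
  assumes "spec n X A \<inter> {z. Re z = 0} = {}"
  shows "causal_spec n X A \<inter> {z. Re z = 0} = {}"
proof -
  define S where "S = {y. \<i> * of_real y \<in> L.resolvent_set B}"
  have axis: "\<i> * of_real y \<in> clin.resolvent_set B" for y
    using assms spec_iff by fastforce
  have "open S"
    unfolding S_def using continuous_open_vimage[OF L.open_resolvent_set[OF clin_B], of "\<lambda>y. \<i> * of_real y"]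
    by (simp add: vimage_def continuous_intros)
  moreover have "closed S"
  proof -
    have "continuous_on UNIV (\<lambda>y. res B (\<i> * of_real y))"
      by (rule continuous_on_compose2[OF continuous_res[OF clin_B]]) (auto intro!: continuous_intros axis)
    then have "closed ((\<lambda>y. res B (\<i> * of_real y)) -` lower)"
      by (rule closed_vimage[OF L.closed_mem])
    then show ?thesis using axis L.resolvent_set_iff by (simp add: S_def vimage_def)
  qed
  \<comment> \<open>Beyond the radius \<open>norm B\<close> the Neumann series gives a lower
    triangular inverse.\<close>
  moreover have "norm B + 1 \<in> S"
    unfolding S_def using norm_ge_zero[of B]
    by (auto intro!: L.resolvent_set_large[OF B_lower] simp: norm_mult simp del: norm_ge_zero)
  ultimately have "S = UNIV" using clopen[of S] by blast
  have "z \<in> L.resolvent_set B" if "Re z = 0" for z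
  proof -
    have "z = \<i> * of_real (Im z)" using that by (simp add: complex_eq_iff)
    then show ?thesis using \<open>S = UNIV\<close> unfolding S_def by (metis (mono_tags) UNIV_I mem_Collect_eq)
  qed
  then show ?thesis using causal_spec_iff by blast
qed

end

lemma circle_winding:
  assumes "r > 0"
  shows "cmod (z - c) < r \<Longrightarrow> winding_number (circlepath c r) z = 1"
    and "cmod (z - c) > r \<Longrightarrow> winding_number (circlepath c r) z = 0"
proof -
  show "cmod (z - c) < r \<Longrightarrow> winding_number (circlepath c r) z = 1"
    by (rule winding_number_circlepath)
  assume "cmod (z - c) > r"
  then show "winding_number (circlepath c r) z = 0"
    using assms by (intro winding_number_zero_outside[where s = "cball c r"])
      (auto simp: dist_norm norm_minus_commute)
qed

lemma surrounds_UNIV_exists: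
  assumes "\<And>z. z \<in> K \<Longrightarrow> cmod z \<le> M" "M \<ge> 0"
  shows "\<exists>\<Gamma>. surrounds UNIV \<Gamma> K"
  using assms circle_winding(1)[of "M + 1" _ 0]
  by (intro exI[of _ "[circlepath 0 (M + 1)]"])
    (fastforce simp: surrounds_def dist_norm)

text \<open>A compact subset of \<open>Re z \<ge> \<delta>\<close>, \<open>\<bar>z\<bar> \<le> M\<close> lies in the disc with centre \<open>r = M\<^sup>2 / \<delta> + \<delta>\<close> and
  radius \<open>r - \<delta> / 2\<close>.\<close>

lemma surrounds_half_planes_exists:
  assumes "closed K" "\<And>z. z \<in> K \<Longrightarrow> cmod z \<le> M" "K \<inter> {z. Re z = 0} = {}"
  shows "\<exists>\<Gamma>. surrounds {z. Re z \<noteq> 0} \<Gamma> K"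
proof -
  have "compact K"
    using assms(1,2) by (auto simp: compact_eq_bounded_closed bounded_iff)
  moreover have "continuous_on K (\<lambda>z. \<bar>Re z\<bar>)" by (intro continuous_intros)
  ultimately have "\<exists>\<delta>>0. \<forall>z\<in>K. \<delta> \<le> \<bar>Re z\<bar>"
  proof (cases "K = {}")
    case False
    with continuous_attains_inf[OF \<open>compact K\<close> False \<open>continuous_on K _\<close>] assms(3) show ?thesis
      by (metis (mono_tags, lifting) disjoint_iff mem_Collect_eq zero_less_abs_iff)
  \<comment> \<open>For empty \<open>K\<close> any positive number will do.\<close>
  qed (auto intro: exI[of _ 1])
  then obtain \<delta> where \<delta>: "\<delta> > 0" "\<And>z. z \<in> K \<Longrightarrow> \<delta> \<le> \<bar>Re z\<bar>" by blast
  define r where "r = M\<^sup>2 / \<delta> + \<delta>"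
  define \<rho> where "\<rho> = r - \<delta> / 2"
  have r\<delta>: "r * \<delta> = M\<^sup>2 + \<delta>\<^sup>2" using \<delta>(1) by (simp add: r_def field_simps power2_eq_square)
  have "r \<ge> \<delta>" using \<delta>(1) by (simp add: r_def)
  then have \<rho>: "\<rho> > 0" "\<rho> < r" using \<delta>(1) by (auto simp: \<rho>_def)
  \<comment> \<open>The sign \<open>s\<close> selects the half-plane, so that both circles are
    treated at once.\<close>
  have inside: "cmod (z - of_real (s * r)) < \<rho>"
    if "cmod z \<le> M" "\<delta> \<le> s * Re z" "s = 1 \<or> s = - 1" for z s
  proof -
    have "(cmod (z - of_real (s * r)))\<^sup>2 = (cmod z)\<^sup>2 - 2 * r * (s * Re z) + r\<^sup>2"
      unfolding cmod_power2 using that(3) by (auto simp: power2_eq_square algebra_simps)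
    also have "\<dots> \<le> M\<^sup>2 - 2 * r * \<delta> + r\<^sup>2"
    proof -
      have "2 * r * \<delta> \<le> 2 * r * (s * Re z)" using that(2) \<rho> by (intro mult_left_mono) auto
      moreover have "(cmod z)\<^sup>2 \<le> M\<^sup>2" using that(1) by (intro power_mono) auto
      ultimately show ?thesis by linarith
    qed
    \<comment> \<open>Amounts to \<open>M^2 < r \<delta> + \<delta>^2 / 4\<close>; the choice of
      \<open>r\<close> makes \<open>r \<delta>\<close> equal to
      \<open>M^2 + \<delta>^2\<close>.\<close>
    also have "\<dots> < \<rho>\<^sup>2"
      using r\<delta> mult_pos_pos[OF \<delta>(1) \<delta>(1)] by (simp add: \<rho>_def power2_eq_square algebra_simps)
    finally show ?thesis using \<rho>(1) by (simp add: power2_less_imp_less)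
  qed
  have outside: "\<rho> < cmod (z - of_real (s * r))" if "s * Re z \<le> 0" "s = 1 \<or> s = - 1" for z s
  proof -
    \<comment> \<open>The axis and the opposite half-plane have distance at least
      \<open>r > \<rho>\<close> from the centre, so each circle has winding number 0 about all of
      their points.\<close>
    have "r \<le> \<bar>Re z - s * r\<bar>" using that \<rho> by auto
    also have "\<dots> \<le> cmod (z - of_real (s * r))" using abs_Re_le_cmod[of "z - of_real (s * r)"] by simp
    finally show ?thesis using \<rho> by simp
  qed
  have K: "(0 < Re z \<and> cmod z \<le> M \<and> \<delta> \<le> 1 * Re z) \<or> (Re z < 0 \<and> cmod z \<le> M \<and> \<delta> \<le> (- 1) * Re z)" if "z \<in> K" for z
    using \<delta>(1) \<delta>(2)[OF that] assms(2)[OF that] by auto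
  have on: "Re z \<noteq> 0 \<and> z \<notin> K" if "cmod (z - of_real (s * r)) = \<rho>" "s = 1 \<or> s = - 1" for z s
  proof -
    have s: "s * Re z > 0" using outside[OF _ that(2), of z] that(1) by force
    moreover have "z \<notin> K"
    proof
      assume "z \<in> K"
      with K[OF this] s that(2) have "cmod z \<le> M" "\<delta> \<le> s * Re z" by auto
      with inside[OF this that(2)] that(1) show False by simp
    qed
    ultimately show ?thesis by auto
  qed
  let ?c = "\<lambda>s. circlepath (of_real (s * r)) \<rho>"
  have "surrounds {z. Re z \<noteq> 0} [?c 1, ?c (- 1)] K"
    unfolding surrounds_def
  proof (intro conjI ballI allI impI)
    fix z assume "z \<in> K"
    then show "(\<Sum>\<gamma>\<leftarrow>[?c 1, ?c (- 1)]. winding_number \<gamma> z) = 1"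
      using K[of z] inside[of z 1] inside[of z "- 1"] outside[of 1 z] outside[of "- 1" z]
      by (auto simp: circle_winding[OF \<rho>(1)])
  next
    fix z assume "z \<notin> {z. Re z \<noteq> 0}"
    then show "(\<Sum>\<gamma>\<leftarrow>[?c 1, ?c (- 1)]. winding_number \<gamma> z) = 0"
      using outside[of 1 z] outside[of "- 1" z] by (auto simp: circle_winding[OF \<rho>(1)])
  next
    fix \<gamma> assume "\<gamma> \<in> set [?c 1, ?c (- 1)]"
    then have "\<gamma> = ?c 1 \<or> \<gamma> = ?c (- 1)" by (simp only: list.set insert_iff empty_iff simp_thms)
    then obtain s where s: "\<gamma> = ?c s" "s = 1 \<or> s = - 1" by blast
    show "path_image \<gamma> \<subseteq> {z. Re z \<noteq> 0} - K"
      using on[OF _ s(2)] \<rho>(1) unfolding s(1) by (auto simp: sphere_def dist_norm norm_minus_commute)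
  qed auto
  then show ?thesis by blast
qed

section \<open>The domains and functions of the theorem\<close>

lemma convex_components_UNIV: "convex_components UNIV"
  by (auto simp: convex_components_def)

lemma convex_components_half_planes: "convex_components {z. Re z \<noteq> 0}"
  unfolding convex_components_def
proof (intro conjI allI impI)
  have eq: "{z. Re z \<noteq> 0} = {z. Re z > 0} \<union> {z. Re z < 0}" by auto
  show "open {z. Re z \<noteq> 0}"
    unfolding eq by (intro open_Un open_halfspace_Re_gt open_halfspace_Re_lt)
  fix S assume S: "connected S \<and> S \<noteq> {} \<and> S \<subseteq> {z. Re z \<noteq> 0}"
  then have "{z. Re z > 0} \<inter> S = {} \<or> {z. Re z < 0} \<inter> S = {}"
    by (intro connectedD[of S]) (auto simp: open_halfspace_Re_gt open_halfspace_Re_lt)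
  then have "S \<subseteq> {z. Re z < 0} \<or> S \<subseteq> {z. Re z > 0}" using S by force
  then show "\<exists>C. open C \<and> convex C \<and> S \<subseteq> C \<and> C \<subseteq> {z. Re z \<noteq> 0}"
    using convex_halfspace_Re_gt[of 0] convex_halfspace_Re_lt[of 0]
      open_halfspace_Re_gt[of 0] open_halfspace_Re_lt[of 0] by (metis (mono_tags) eq sup_ge1 sup_ge2)
qed

lemma holomorphic_exp_plus: "exp_plus t holomorphic_on S"
  and holomorphic_exp_minus: "exp_minus t holomorphic_on S"
  unfolding exp_plus_def exp_minus_def
  by (cases "t > 0"; auto intro!: holomorphic_intros)+

text \<open>The two branches live on disjoint open half-planes and never have to match along the
  axis.\<close>

lemma holomorphic_g_fun: "g_fun t holomorphic_on {z. Re z \<noteq> 0}"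
proof -
  have eq: "{z. Re z \<noteq> 0} = {z. Re z > 0} \<union> {z. Re z < 0}" by auto
  have "g_fun t holomorphic_on {z. Re z > 0}"
    by (rule holomorphic_transform[OF holomorphic_exp_minus[of t]]) (simp add: g_fun_def)
  moreover have "g_fun t holomorphic_on {z. Re z < 0}"
    by (rule holomorphic_transform[OF holomorphic_exp_plus[of t]]) (simp add: g_fun_def)
  ultimately show ?thesis
    unfolding eq by (intro holomorphic_on_Un open_halfspace_Re_gt open_halfspace_Re_lt)
qed

theorem theorem19:
  fixes n :: nat and X :: "nat \<Rightarrow> 'a::complex_banach set" and A :: "'a opmat" and t :: real
  assumes "direct_decomp n X"
    and "A \<in> lower_opmats n X"
    and "t \<noteq> 0"
  shows
    "(\<forall>f \<in> {exp_plus t, exp_minus t}.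
        func_calc n X UNIV f A \<in> lower_opmats n X \<and>
        (\<forall>i\<in>{1..n}. \<forall>j\<in>{1..i}.
           func_calc n X UNIV f A i j = (\<Sum>is\<in>decreasing_seqs i j. divdiff_calc n X UNIV f A is)))
     \<and>
     (spec n X A \<inter> {z. Re z = 0} = {} \<longrightarrow>
        func_calc n X {z. Re z \<noteq> 0} (g_fun t) A \<in> lower_opmats n X \<and>
        (\<forall>i\<in>{1..n}. \<forall>j\<in>{1..i}.
           func_calc n X {z. Re z \<noteq> 0} (g_fun t) A i j =
             (\<Sum>is\<in>decreasing_seqs i j. divdiff_calc n X {z. Re z \<noteq> 0} (g_fun t) A is)))"
proof -
  interpret direct_sum n X
    by unfold_locales (rule assms(1))
  have "A \<in> opmats n X" using assms(2) by (simp add: lower_opmats_def)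
  \<comment> \<open>The operator theory is applied to \<open>tot A\<close>, whose blocks are the
    entries of \<open>A\<close>.\<close>
  then have "A = cut (tot A)" by (simp add: cut_tot)
  moreover from this have "tot A \<in> lower" using assms(2) cut_lower_iff by metis
  ultimately interpret lower_matrix n X A "tot A"
    by unfold_locales
  have ex: "\<exists>\<Gamma>. surrounds UNIV \<Gamma> (causal_spec n X A)"
    using surrounds_UNIV_exists[OF causal_spec_bound norm_ge_zero] .
  have ex': "\<exists>\<Gamma>. surrounds {z. Re z \<noteq> 0} \<Gamma> (causal_spec n X A)" if "spec n X A \<inter> {z. Re z = 0} = {}"
    using surrounds_half_planes_exists[OF closed_causal_spec causal_spec_bound causal_spec_imaginary_axis[OF that]] .
  have hol: "f holomorphic_on UNIV" if "f \<in> {exp_plus t, exp_minus t}" for f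
    using that holomorphic_exp_plus holomorphic_exp_minus by auto
  show ?thesis
  proof (intro conjI ballI impI)
    fix f assume "f \<in> {exp_plus t, exp_minus t}"
    note f = func_calc_lower[OF convex_components_UNIV hol[OF this] ex]
    show "func_calc n X UNIV f A \<in> lower_opmats n X" by (rule f)
    fix i j assume "i \<in> {1..n}" "j \<in> {1..i}"
    then show "func_calc n X UNIV f A i j = (\<Sum>is\<in>decreasing_seqs i j. divdiff_calc n X UNIV f A is)"
      by (rule f)
  next
    assume "spec n X A \<inter> {z. Re z = 0} = {}"
    note g = func_calc_lower[OF convex_components_half_planes holomorphic_g_fun ex'[OF this]]
    show "func_calc n X {z. Re z \<noteq> 0} (g_fun t) A \<in> lower_opmats n X" by (rule g)
    fix i j assume "i \<in> {1..n}" "j \<in> {1..i}"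
    then show "func_calc n X {z. Re z \<noteq> 0} (g_fun t) A i j =
        (\<Sum>is\<in>decreasing_seqs i j. divdiff_calc n X {z. Re z \<noteq> 0} (g_fun t) A is)"
      by (rule g)
  qed
qed

end
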